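(* Let $\phi,\psi,Y$ be as in the context. Then $\mu(dx)=2^{-1}dx$ on $[-1,1]$ is an invariant probability measure for $Y^{\mathrm{NN}}=\mathrm N^r(\mathrm N^l(Y))$, i.e. $\mathbb P_\mu[Y^{\mathrm{NN}}_t\in dx]=\mu(dx)$ for all $t>0$.
   Context: $\phi$ is a nonnegative Borel measure on $(0,\infty)$ with $\int_{(0,\infty)}(y^2\wedge y)\,\phi(dy)<\infty$ and $\int_{(0,1)}y\,\phi(dy)=\infty$; $\psi(\xi)=\int_{(0,\infty)}(e^{-\xi y}-1+\xi y)\,\phi(dy)$, $\Re\xi\ge0$. $Y$ is the càdlàg spectrally positive Lévy process with $\mathbb E_0[e^{-\xi Y_1}]=e^{\psi(\xi)}$; $\mathbb P_\mu$ is the law when the initial distribution is $\mu$. Fast-forwarding maps: $\mathrm N^l(f)=f(A_f^{-1})$ with $A_f(t)=\int_0^t\mathbf 1_{\{f(z)>-1\}}dz$ and $\mathrm N^r(f)=f(A_f^{-1})$ with $A_f(t)=\int_0^t\mathbf 1_{\{f(z)<1\}}dz$, where $A_f^{-1}(t)=\inf\{s>0:A_f(s)>t\}$. Thus $Y^{\mathrm{NN}}$ is $Y$ with the time spent outside $(-1,1)$ deleted. *)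

theory Defs
  imports "HOL-Probability.Probability"
begin

text \<open>Paths are functions \<open>real \<Rightarrow> real\<close> of which only the values at times \<open>t \<ge> 0\<close> are relevant.\<close>

definition cadlag :: "(real \<Rightarrow> real) \<Rightarrow> bool" where
  "cadlag f \<longleftrightarrow>
     (\<forall>t\<ge>0. continuous (at_right t) f) \<and>
     (\<forall>t>0. \<exists>l. (f \<longlongrightarrow> l) (at_left t))"

text \<open>The independent family consists of the initial value and the increments along
  \<open>0 = \<tau> 0 < \<dots> < \<tau> n\<close>, so the increments are also independent of the random starting point.\<close>

definition levy_process_from :: "real measure \<Rightarrow> 'a measure \<Rightarrow> (real \<Rightarrow> 'a \<Rightarrow> real) \<Rightarrow> bool" where
  "levy_process_from \<mu> M Y \<longleftrightarrow>
     prob_space M \<and>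
     (\<forall>t\<ge>0. Y t \<in> borel_measurable M) \<and>
     distr M borel (Y 0) = \<mu> \<and>
     (\<forall>n \<tau>. \<tau> 0 = 0 \<and> (\<forall>i<n. \<tau> i < \<tau> (Suc i)) \<longrightarrow>
        prob_space.indep_vars M (\<lambda>_. borel)
          (\<lambda>i \<omega>. if i = 0 then Y 0 \<omega> else Y (\<tau> i) \<omega> - Y (\<tau> (i - 1)) \<omega>) {..n::nat}) \<and>
     (\<forall>s\<ge>0. \<forall>t\<ge>0. distr M borel (\<lambda>\<omega>. Y (s + t) \<omega> - Y s \<omega>)
                   = distr M borel (\<lambda>\<omega>. Y t \<omega> - Y 0 \<omega>)) \<and>
     (\<forall>\<omega>\<in>space M. cadlag (\<lambda>t. Y t \<omega>))"

text \<open>A Borel measure on the open half-line: its space is \<open>{0<..}\<close>, so all integrals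
  against \<open>\<phi>\<close> are over the open half-line.\<close>

definition admissible_jump_measure :: "real measure \<Rightarrow> bool" where
  "admissible_jump_measure \<phi> \<longleftrightarrow>
     sets \<phi> = sets (restrict_space borel {0<..}) \<and>
     (\<integral>\<^sup>+ y. ennreal (min (y\<^sup>2) y) \<partial>\<phi>) < \<infinity> \<and>
     (\<integral>\<^sup>+ y\<in>{0<..<1}. ennreal y \<partial>\<phi>) = \<infinity>"

definition laplace_exponent :: "real measure \<Rightarrow> complex \<Rightarrow> complex" where
  "laplace_exponent \<phi> \<xi> =
     (LINT y|\<phi>. exp (- \<xi> * complex_of_real y) - 1 + \<xi> * complex_of_real y)"

text \<open>The law of \<open>Y 1\<close> for the process started at \<open>0\<close> is the law of \<open>Y 1 - Y 0\<close> for any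
  initial distribution. As \<open>exp\<close> never vanishes, the equation forces integrability.\<close>

definition has_laplace_exponent ::
    "'a measure \<Rightarrow> (real \<Rightarrow> 'a \<Rightarrow> real) \<Rightarrow> (complex \<Rightarrow> complex) \<Rightarrow> bool" where
  "has_laplace_exponent M Y \<psi> \<longleftrightarrow>
     (\<forall>\<xi>. Re \<xi> \<ge> 0 \<longrightarrow>
        (LINT \<omega>|M. exp (- \<xi> * complex_of_real (Y 1 \<omega> - Y 0 \<omega>))) = exp (\<psi> \<xi>))"

definition clock_l :: "(real \<Rightarrow> real) \<Rightarrow> real \<Rightarrow> real" where
  "clock_l f t = (LINT z:{0..t}|lborel. (if f z > - 1 then 1 else 0))"

definition clock_r :: "(real \<Rightarrow> real) \<Rightarrow> real \<Rightarrow> real" where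
  "clock_r f t = (LINT z:{0..t}|lborel. (if f z < 1 then 1 else 0))"

text \<open>Extended-real valued, so that \<open>inverse_clock A t = \<infinity>\<close> if \<open>A\<close> never exceeds \<open>t\<close>.\<close>

definition inverse_clock :: "(real \<Rightarrow> real) \<Rightarrow> real \<Rightarrow> ereal" where
  "inverse_clock A t = Inf (ereal ` {s. s > 0 \<and> A s > t})"

text \<open>If the inverse clock is infinite, \<open>real_of_ereal\<close> returns \<open>0\<close> and the value of the
  time-changed path is a dummy; \<open>NN_well_defined\<close> says that this never happens.\<close>

definition N_l :: "(real \<Rightarrow> real) \<Rightarrow> real \<Rightarrow> real" where
  "N_l f t = f (real_of_ereal (inverse_clock (clock_l f) t))"

definition N_r :: "(real \<Rightarrow> real) \<Rightarrow> real \<Rightarrow> real" where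
  "N_r f t = f (real_of_ereal (inverse_clock (clock_r f) t))"

definition NN_well_defined :: "(real \<Rightarrow> real) \<Rightarrow> bool" where
  "NN_well_defined f \<longleftrightarrow>
     (\<forall>t\<ge>0. inverse_clock (clock_l f) t < \<infinity>) \<and>
     (\<forall>t\<ge>0. inverse_clock (clock_r (N_l f)) t < \<infinity>)"

definition Y_NN :: "(real \<Rightarrow> 'a \<Rightarrow> real) \<Rightarrow> real \<Rightarrow> 'a \<Rightarrow> real" where
  "Y_NN Y t \<omega> = N_r (N_l (\<lambda>s. Y s \<omega>)) t"

definition half_lebesgue :: "real measure" where
  "half_lebesgue = density lborel (\<lambda>x. ennreal (1 / 2) * indicator {-1..1} x)"

end

theory Submission imports Defs begin

text \<open>Write \<open>D\<close> for the open interval from \<open>-1\<close> to \<open>1\<close>. Deleting the time below \<open>-1\<close> and then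
  the time above \<open>1\<close> amounts to running \<open>Y\<close> along the right-continuous inverse \<open>\<tau>\<close> of the occupation
  time \<open>A\<close> of \<open>D\<close>. Start the increments \<open>Z = Y - Y 0\<close> from Lebesgue measure on the whole line: the
  path \<open>X = x + Z\<close> is then stationary under time shifts, with an infinite invariant measure \<open>m\<close>.
  For a Borel set \<open>E\<close>, integrate over \<open>s \<le> T\<close> the event that \<open>X s \<in> D\<close> and that the path shifted by
  \<open>s\<close> is in \<open>E\<close> at its time \<open>\<tau> t\<close>. By stationarity this has mean \<open>T * m (X 0 \<in> D, X (\<tau> t) \<in> E)\<close>;
  the substitution \<open>v = A s\<close> shows that pathwise it exceeds the time spent in \<open>D \<inter> E\<close> up to time \<open>T\<close> by
  at most \<open>min t (A T)\<close>. So it is enough that the \<open>m\<close>-integral of \<open>min t (A T)\<close> is \<open>o(T)\<close>. Paths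
  starting within \<open>\<epsilon> T\<close> of the origin contribute at most \<open>2 \<epsilon> T t\<close>, and the others have to
  travel a distance of order \<open>\<epsilon> T\<close> before reaching \<open>D\<close>, which the weak law of large numbers for
  \<open>Z\<close> makes unlikely. Counting the event \<open>\<tau> t = \<infinity>\<close> as a hit of every \<open>E\<close> yields recurrence from the
  case \<open>E = {}\<close>.\<close>

section \<open>Occupation clocks and their inverses\<close>

text \<open>An arbitrary set \<open>C\<close> of times lets the half-line clocks, the clock of the
  interval and the clocks of shifted paths share one theory. For negative \<open>t\<close> the
  interval is empty and the value is 0.\<close>

definition occ :: "real set \<Rightarrow> real \<Rightarrow> real" where
  "occ C t = measure lborel (C \<inter> {0..t})"

lemma occ_nonneg: "0 \<le> occ C t"
  by (simp add: occ_def)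

lemma occ_nonpos: "t \<le> 0 \<Longrightarrow> occ C t = 0"
proof -
  assume "t \<le> 0"
  then have "C \<inter> {0..t} \<subseteq> {0}" by auto
  then have "C \<inter> {0..t} = {} \<or> C \<inter> {0..t} = {0}" by blast
  then show ?thesis unfolding occ_def by (elim disjE) (simp_all add: measure_def)
qed

lemma finite_Icc_lborel: "C \<in> sets borel \<Longrightarrow> C \<inter> {a..b::real} \<in> fmeasurable lborel"
  by (rule fmeasurableI2[of "{a..b}"]) (auto intro!: fmeasurableI simp: emeasure_lborel_Icc_eq)

lemma occ_add_raw:
  assumes C: "C \<in> sets borel" and "0 \<le> s" "s \<le> t"
  shows "occ C t = occ C s + measure lborel (C \<inter> {s<..t})"
proof -
  have 1: "C \<inter> {s<..t} \<in> fmeasurable lborel"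
    by (rule fmeasurableI2[of "{s..t}"]) (use C in \<open>auto intro!: fmeasurableI simp: emeasure_lborel_Icc_eq\<close>)
  have "C \<inter> {0..t} = (C \<inter> {0..s}) \<union> (C \<inter> {s<..t})" using assms by auto
  moreover have "(C \<inter> {0..s}) \<inter> (C \<inter> {s<..t}) = {}" by auto
  ultimately show ?thesis unfolding occ_def
    using measure_Un3[OF finite_Icc_lborel[OF C, of 0 s] 1] by simp
qed

lemma occ_mono: "C \<in> sets borel \<Longrightarrow> s \<le> t \<Longrightarrow> occ C s \<le> occ C t"
  unfolding occ_def by (rule measure_mono_fmeasurable) (auto intro: finite_Icc_lborel)

lemma occ_lipschitz: "C \<in> sets borel \<Longrightarrow> s \<le> t \<Longrightarrow> occ C t \<le> occ C s + (t - s)"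
proof -
  assume C: "C \<in> sets borel" and "s \<le> t"
  have *: "measure lborel (C \<inter> {s<..t}) \<le> t - s" if "s \<le> t" for s t :: real
  proof -
    have "measure lborel (C \<inter> {s<..t}) \<le> measure lborel {s..t}"
      by (rule measure_mono_fmeasurable) (use C in \<open>auto intro!: fmeasurableI simp: emeasure_lborel_Icc_eq\<close>)
    then show ?thesis using that by simp
  qed
  consider "t \<le> 0" | "s \<le> 0" "0 \<le> t" | "0 \<le> s" using \<open>s \<le> t\<close> by linarith
  then show ?thesis
  proof cases
    case 1 then show ?thesis using occ_nonpos[of t C] occ_nonneg[of C s] \<open>s \<le> t\<close> by simp
  next
    case 2 then show ?thesis
      using occ_add_raw[OF C, of 0 t] *[of 0 t] occ_nonpos[of 0 C] occ_nonneg[of C s] by simp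
  next
    case 3 then show ?thesis using occ_add_raw[OF C, of s t] *[of s t] \<open>s \<le> t\<close> by simp
  qed
qed

text \<open>Translation invariance of Lebesgue measure; the endpoint \<open>s\<close>, lost in
  passing to a half-open interval, is null.\<close>

lemma occ_shift:
  assumes C: "C \<in> sets borel" and s: "0 \<le> s" "0 \<le> u"
  shows "occ {u. 0 \<le> u \<and> s + u \<in> C} u = occ C (s + u) - occ C s"
proof -
  have "measure lborel ({v. 0 \<le> v \<and> s + v \<in> C} \<inter> {0..u}) = measure lborel (C \<inter> {s..s+u})"
  proof -
    have "lborel = distr lborel borel (\<lambda>x. s + x)" by (rule lborel_distr_plus[symmetric])
    then have "emeasure lborel (C \<inter> {s..s+u}) = emeasure (distr lborel borel (\<lambda>x. s + x)) (C \<inter> {s..s+u})" by simp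
    also have "\<dots> = emeasure lborel ((\<lambda>x. s + x) -` (C \<inter> {s..s+u}))"
      by (subst emeasure_distr) (use C in auto)
    also have "(\<lambda>x. s + x) -` (C \<inter> {s..s+u}) = {v. 0 \<le> v \<and> s + v \<in> C} \<inter> {0..u}" by auto
    finally show ?thesis by (simp add: measure_def)
  qed
  moreover have "measure lborel (C \<inter> {s..s+u}) = measure lborel (C \<inter> {s<..s+u})"
  proof (rule measure_eq_AE)
    show "AE x in lborel. x \<in> C \<inter> {s..s + u} \<longleftrightarrow> x \<in> C \<inter> {s<..s + u}"
      using AE_lborel_singleton[of s] by eventually_elim auto
  qed (use C in auto)
  ultimately show ?thesis using occ_add_raw[OF C, of s "s+u"] s by (simp add: occ_def)
qed

lemma occ_continuous: "C \<in> sets borel \<Longrightarrow> isCont (occ C) s"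
proof -
  assume C: "C \<in> sets borel"
  have "\<bar>occ C x - occ C s\<bar> \<le> \<bar>x - s\<bar>" for x
    using occ_lipschitz[OF C, of x s] occ_lipschitz[OF C, of s x] occ_mono[OF C, of x s] occ_mono[OF C, of s x]
    by (cases "x \<le> s") auto
  then have 1: "norm (occ C x - occ C s) \<le> \<bar>x - s\<bar>" for x by simp
  have "((\<lambda>x. \<bar>x - s\<bar>) \<longlongrightarrow> 0) (at s)" by (auto intro!: tendsto_eq_intros)
  then have "((\<lambda>x. occ C x - occ C s) \<longlongrightarrow> 0) (at s)"
    by (rule Lim_null_comparison[rotated]) (use 1 in auto)
  then show ?thesis unfolding isCont_def by (simp add: LIM_zero_iff)
qed

lemma occ_borel_measurable [measurable]: "C \<in> sets borel \<Longrightarrow> occ C \<in> borel_measurable borel"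
  by (intro borel_measurable_continuous_onI continuous_at_imp_continuous_on ballI occ_continuous)

section \<open>Right-continuous inverses of clocks\<close>

lemma inverse_clock_eqI:
  assumes "\<And>u. 0 < u \<Longrightarrow> t < a u \<longleftrightarrow> b < u" "0 \<le> b"
  shows "inverse_clock a t = ereal b"
proof -
  have "{s. s > 0 \<and> a s > t} = {b<..}" using assms by auto
  moreover have "Inf (ereal ` {b<..}) = ereal b"
  proof (rule antisym)
    show "ereal b \<le> Inf (ereal ` {b<..})" by (rule Inf_greatest) auto
    show "Inf (ereal ` {b<..}) \<le> ereal b"
    proof (rule ereal_le_epsilon2)
      fix e :: real assume "0 < e"
      then have "Inf (ereal ` {b<..}) \<le> ereal (b + e)" by (intro Inf_lower) auto
      then show "Inf (ereal ` {b<..}) \<le> ereal b + ereal e" by simp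
    qed
  qed
  ultimately show ?thesis by (simp add: inverse_clock_def)
qed

lemma inverse_clock_infinite_iff:
  "inverse_clock a t = \<infinity> \<longleftrightarrow> (\<forall>u>0. a u \<le> t)"
proof
  assume inf: "inverse_clock a t = \<infinity>"
  show "\<forall>u>0. a u \<le> t"
  proof (intro allI impI, rule ccontr)
    fix u :: real assume "0 < u" "\<not> a u \<le> t"
    then have "inverse_clock a t \<le> ereal u" unfolding inverse_clock_def by (intro Inf_lower) auto
    then show False using inf by simp
  qed
next
  assume "\<forall>u>0. a u \<le> t"
  then have "{s. s > 0 \<and> a s > t} = {}" by (auto simp: not_less)
  then show "inverse_clock a t = \<infinity>" unfolding inverse_clock_def by (simp only: image_empty) (simp add: top_ereal_def)
qed

lemma inverse_clock_nonneg: "0 \<le> inverse_clock a t"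
  unfolding inverse_clock_def by (rule Inf_greatest) auto

lemma real_inverse_clock_nonneg: "0 \<le> real_of_ereal (inverse_clock a t)"
  by (rule real_of_ereal_pos[OF inverse_clock_nonneg])

text \<open>The clock is continuous and nondecreasing, so the infimum \<open>b\<close> of the times
  at which it exceeds \<open>t\<close> is the last time at which it equals \<open>t\<close>. The
  equivalence of \<open>t < occ C u\<close> and \<open>b < u\<close> is the form in which inverse
  clocks are compared later.\<close>

lemma inverse_clock_occ:
  assumes C: "C \<in> sets borel" and fin: "inverse_clock (occ C) t \<noteq> \<infinity>" and t: "0 \<le> t"
  obtains b where "0 \<le> b" "inverse_clock (occ C) t = ereal b" "\<And>u. t < occ C u \<longleftrightarrow> b < u"
    "occ C b = t"
proof -
  define S where "S = {s. s > 0 \<and> occ C s > t}"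
  obtain u0 where u0: "u0 \<in> S" using fin unfolding inverse_clock_infinite_iff S_def by (auto simp: not_le)
  define b where "b = Inf S"
  have bdd: "bdd_below S" unfolding S_def by (auto intro!: bdd_belowI[of _ 0])
  have b0: "0 \<le> b" unfolding b_def by (rule cInf_greatest) (use u0 in \<open>auto simp: S_def\<close>)
  have gt: "t < occ C u" if "b < u" for u
  proof -
    have "S \<noteq> {}" using u0 by blast
    then obtain s where "s \<in> S" "s < u" using cInf_lessD[of S u] \<open>b < u\<close>[unfolded b_def] by metis
    then show ?thesis using occ_mono[OF C, of s u] by (auto simp: S_def)
  qed
  have ge: "occ C b \<ge> t"
  proof (rule field_le_epsilon)
    fix e :: real assume "0 < e"
    then show "t \<le> occ C b + e" using gt[of "b + e"] occ_lipschitz[OF C, of b "b+e"] by simp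
  qed
  have le: "occ C b \<le> t"
  proof (rule ccontr)
    assume "\<not> occ C b \<le> t"
    then have less: "t < occ C b" by simp
    then have "0 < b" using occ_nonpos[of b C] t by (cases "b \<le> 0") auto
    \<comment> \<open>The bound \<open>b/2\<close> keeps \<open>b - e\<close> positive, as
      membership in \<open>S\<close> requires; the other bound is half the excess, so the
      1-Lipschitz clock is still above \<open>t\<close> at \<open>b - e\<close>.\<close>
    define e where "e = min (b/2) ((occ C b - t)/2)"
    have e: "0 < e" "e \<le> b/2" "e \<le> (occ C b - t)/2"
      using less \<open>0 < b\<close> min.cobounded2[of "b/2" "(occ C b - t)/2"] unfolding e_def by simp_all
    have "t < occ C (b - e)" using occ_lipschitz[OF C, of "b - e" b] e less by (simp add: field_simps)
    then have "b - e \<in> S" using e \<open>0 < b\<close> by (auto simp: S_def)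
    then have "b \<le> b - e" unfolding b_def by (rule cInf_lower[OF _ bdd])
    then show False using e by simp
  qed
  have iff: "t < occ C u \<longleftrightarrow> b < u" for u
    using gt[of u] occ_mono[OF C, of u b] le by (cases "b < u") auto
  show ?thesis using inverse_clock_eqI[of t "occ C" b] b0 iff le ge by (intro that[of b]) auto
qed

text \<open>A countable infimum gives measurability. A time \<open>s\<close> with
  \<open>t < a s\<close> may be replaced by a rational slightly above it, since \<open>a\<close> is
  nondecreasing.\<close>

lemma inverse_clock_INF:
  assumes "\<And>s u. s \<le> u \<Longrightarrow> a s \<le> a u"
  shows "inverse_clock a t = (INF q\<in>{q\<in>\<rat>. 0 < q}. if t < a q then ereal q else \<infinity>)"
proof (rule antisym)
  show "inverse_clock a t \<le> (INF q\<in>{q\<in>\<rat>. 0 < q}. if t < a q then ereal q else \<infinity>)"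
    unfolding inverse_clock_def by (intro INF_greatest) (auto intro!: Inf_lower)
  show "(INF q\<in>{q\<in>\<rat>. 0 < q}. if t < a q then ereal q else \<infinity>) \<le> inverse_clock a t" (is "?I \<le> _")
    unfolding inverse_clock_def
  proof (rule Inf_greatest, safe)
    fix s assume s: "0 < s" "t < a s"
    show "?I \<le> ereal s"
    proof (rule ereal_le_epsilon2)
      fix e :: real assume "0 < e"
      then obtain q where q: "q \<in> \<rat>" "s < q" "q < s + e" using Rats_dense_in_real[of s "s+e"] by auto
      then have "?I \<le> (if t < a q then ereal q else \<infinity>)" using s by (intro INF_lower) auto
      also have "\<dots> = ereal q" using assms[of s q] q s by auto
      finally show "?I \<le> ereal s + ereal e" using q by (simp add: order_trans[of _ "ereal q"])
    qed
  qed
qed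

lemma countable_pos_Rats: "countable {q\<in>\<rat>. (0::real) < q}"
  by (rule countable_subset[OF _ countable_rat]) auto

lemma inverse_clock_occ_measurable [measurable]:
  assumes C: "C \<in> sets borel"
  shows "inverse_clock (occ C) \<in> borel_measurable borel"
proof -
  have "(\<lambda>t. INF q\<in>{q\<in>\<rat>. (0::real) < q}. if t < occ C q then ereal q else \<infinity>) \<in> borel_measurable borel"
    by (rule borel_measurable_INF[OF countable_pos_Rats]) measurable
  also have "(\<lambda>t. INF q\<in>{q\<in>\<rat>. (0::real) < q}. if t < occ C q then ereal q else \<infinity>) = inverse_clock (occ C)"
    by (rule ext, rule inverse_clock_INF[symmetric]) (rule occ_mono[OF C])
  finally show ?thesis .
qed

text \<open>Finite Borel measures are determined by the half-lines \<open>{..v}\<close>. For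
  \<open>0 \<le> v\<close> below \<open>occ C T\<close> the inverse clock gives a \<open>b\<close>
  such that \<open>occ C s \<le> v\<close> exactly when \<open>s \<le> b\<close>. Hence
  \<open>N1\<close>, the image of Lebesgue measure on \<open>C \<inter> {0..T}\<close>, and
  \<open>N2\<close>, Lebesgue measure on \<open>{0..occ C T}\<close>, both give the half-line mass
  \<open>v\<close>.\<close>

lemma occ_change_of_variables:
  assumes C: "C \<in> sets borel" and T: "0 \<le> T" and H: "H \<in> borel_measurable borel"
  shows "(\<integral>\<^sup>+ s. H (occ C s) * indicator (C \<inter> {0..T}) s \<partial>lborel)
       = (\<integral>\<^sup>+ v. H v * indicator {0..occ C T} v \<partial>lborel)"
proof -
  define N1 where "N1 = distr (density lborel (indicator (C \<inter> {0..T}))) borel (occ C)"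
  define N2 where "N2 = density lborel (indicator {0..occ C T} :: real \<Rightarrow> ennreal)"
  have s[measurable]: "C \<in> sets borel" by (fact C)
  have em1: "emeasure N1 B = emeasure lborel (C \<inter> {0..T} \<inter> occ C -` B)" if [measurable]: "B \<in> sets borel" for B
  proof -
    have "emeasure N1 B = emeasure (density lborel (indicator (C \<inter> {0..T}))) (occ C -` B)"
      unfolding N1_def by (subst emeasure_distr) auto
    also have "\<dots> = emeasure lborel (C \<inter> {0..T} \<inter> occ C -` B)"
      using measurable_sets_borel[OF occ_borel_measurable[OF C] that]
      by (subst emeasure_density) (auto simp flip: indicator_inter_arith)
    finally show ?thesis .
  qed
  have em2: "emeasure N2 B = emeasure lborel ({0..occ C T} \<inter> B)" if [measurable]: "B \<in> sets borel" for B
    unfolding N2_def by (subst emeasure_density) (auto simp flip: indicator_inter_arith)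
  have emC: "emeasure lborel (C \<inter> {0..b}) = ennreal (occ C b)" for b
    unfolding occ_def by (rule emeasure_eq_measure2[OF finite_Icc_lborel[OF C]])
  have eq: "emeasure N1 {..v} = emeasure N2 {..v}" for v
  proof -
    consider "v < 0" | "0 \<le> v" "v < occ C T" | "0 \<le> v" "occ C T \<le> v" by linarith
    then show ?thesis
    proof cases
      case 1
      then have "C \<inter> {0..T} \<inter> occ C -` {..v} = {}" "{0..occ C T} \<inter> {..v} = {}"
        using order.strict_trans2[OF 1 occ_nonneg[of C]] by (auto simp flip: not_less)
      then show ?thesis by (simp add: em1 em2)
    next
      case 2
      have "0 < T" using 2 occ_nonpos[of T C] by (cases "T \<le> 0") auto
      then have "inverse_clock (occ C) v \<noteq> \<infinity>" using 2 by (auto simp: inverse_clock_infinite_iff not_le)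
      from inverse_clock_occ[OF C this 2(1)] obtain b where
        b: "0 \<le> b" "\<And>u. v < occ C u \<longleftrightarrow> b < u" "occ C b = v" by metis
      have "C \<inter> {0..T} \<inter> occ C -` {..v} = C \<inter> {0..b}"
      proof -
        have "b < T" using b(2)[of T] 2 by blast
        moreover have "occ C u \<le> v \<longleftrightarrow> u \<le> b" for u using b(2)[of u] by linarith
        ultimately show ?thesis by auto
      qed
      moreover have "{0..occ C T} \<inter> {..v} = {0..v}" using 2 by auto
      ultimately show ?thesis using 2 by (simp add: em1 em2 emC b)
    next
      case 3
      then have "C \<inter> {0..T} \<inter> occ C -` {..v} = C \<inter> {0..T}" "{0..occ C T} \<inter> {..v} = {0..occ C T}"
        using order_trans[OF occ_mono[OF C] 3(2)] by auto
      then show ?thesis by (simp add: em1 em2 emC occ_nonneg)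
    qed
  qed
  have fb: "finite_borel_measure N1" "finite_borel_measure N2"
    unfolding finite_borel_measure_def finite_borel_measure_axioms_def
    using em1[of UNIV] em2[of UNIV]
    by (safe intro!: finite_measureI) (simp_all add: N1_def N2_def emC emeasure_lborel_Icc_eq occ_nonneg)
  have "N1 = N2"
    by (rule cdf_unique'[OF fb]) (simp add: cdf_def measure_def eq fun_eq_iff)
  then have "(\<integral>\<^sup>+ v. H v \<partial>N1) = (\<integral>\<^sup>+ v. H v \<partial>N2)" by simp
  moreover have "(\<integral>\<^sup>+ v. H v \<partial>N1) = (\<integral>\<^sup>+ s. H (occ C s) * indicator (C \<inter> {0..T}) s \<partial>lborel)"
    unfolding N1_def using H by (simp add: nn_integral_distr nn_integral_density mult.commute)
  moreover have "(\<integral>\<^sup>+ v. H v \<partial>N2) = (\<integral>\<^sup>+ v. H v * indicator {0..occ C T} v \<partial>lborel)"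
    unfolding N2_def using H by (simp add: nn_integral_density mult.commute)
  ultimately show ?thesis by simp
qed

section \<open>Time change by the occupation clock of an open set\<close>

definition visits :: "real set \<Rightarrow> (real \<Rightarrow> real) \<Rightarrow> real set" where
  "visits U w = {s. 0 \<le> s \<and> w s \<in> U}"

definition right_cont_path :: "(real \<Rightarrow> real) \<Rightarrow> bool" where
  "right_cont_path w \<longleftrightarrow> (\<forall>t\<ge>0. continuous (at_right t) w)"

text \<open>Counting an infinite inverse clock as a hit makes the behaviour under time shifts exact
  before recurrence is known.\<close>

definition trace_hits :: "real set \<Rightarrow> (real \<Rightarrow> real) \<Rightarrow> real \<Rightarrow> real set \<Rightarrow> bool" where
  "trace_hits U w t E \<longleftrightarrow> inverse_clock (occ (visits U w)) t = \<infinity>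
     \<or> w (real_of_ereal (inverse_clock (occ (visits U w)) t)) \<in> E"

lemma visits_borel: "w \<in> borel_measurable borel \<Longrightarrow> U \<in> sets borel \<Longrightarrow> visits U w \<in> sets borel"
proof -
  assume [measurable]: "w \<in> borel_measurable borel" "U \<in> sets borel"
  have "{s \<in> space borel. 0 \<le> s \<and> w s \<in> U} \<in> sets borel" by measurable
  then show ?thesis by (simp add: visits_def)
qed

lemma visits_right_open:
  assumes "right_cont_path w" "open U" "s \<in> visits U w"
  obtains e where "0 < e" "{s..<s+e} \<subseteq> visits U w"
proof -
  have "0 \<le> s" "w s \<in> U" using assms(3) by (auto simp: visits_def)
  then have "(w \<longlongrightarrow> w s) (at_right s)" using assms(1) by (simp add: right_cont_path_def continuous_within)
  then have "eventually (\<lambda>u. w u \<in> U) (at_right s)" using \<open>open U\<close> \<open>w s \<in> U\<close> by (rule topological_tendstoD)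
  then obtain b where "s < b" "\<And>u. s < u \<Longrightarrow> u < b \<Longrightarrow> w u \<in> U"
    unfolding eventually_at_right_field by blast
  then have "{s..<s+(b-s)} \<subseteq> visits U w" 
    using \<open>0 \<le> s\<close> \<open>w s \<in> U\<close> by (auto simp: visits_def le_less)
  then show ?thesis using that[of "b - s"] \<open>s < b\<close> by simp
qed

text \<open>Just after \<open>s\<close> the clock runs at unit speed, so it is strictly larger at
  every later time and the infimum defining the inverse is \<open>s\<close>. Openness of
  \<open>U\<close> and right-continuity of the path supply such an \<open>e\<close> at every
  visit.\<close>

lemma inverse_clock_occ_self:
  assumes C: "C \<in> sets borel" and s: "0 \<le> s" and e: "0 < e" "{s..<s+e} \<subseteq> C"
  shows "inverse_clock (occ C) (occ C s) = ereal s"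
proof (rule inverse_clock_eqI)
  fix u :: real
  show "occ C s < occ C u \<longleftrightarrow> s < u"
  proof
    assume "s < u"
    define v where "v = min u (s + e/2)"
    have v: "s < v" "v \<le> u" "v < s + e" using \<open>s < u\<close> e by (auto simp: v_def min_def)
    have "C \<inter> {s<..v} = {s<..v}" using v e by auto
    then have "occ C v = occ C s + (v - s)" using occ_add_raw[OF C s, of v] v by simp
    then show "occ C s < occ C u" using occ_mono[OF C v(2)] v by simp
  next
    assume "occ C s < occ C u" then show "s < u" using occ_mono[OF C, of u s] by (cases "u \<le> s") auto
  qed
qed (rule s)

text \<open>Restarting the path at \<open>s\<close> subtracts \<open>occ (visits U w) s\<close> from
  the clock. The inverse clock of the shifted path at level \<open>t\<close> is therefore that of
  \<open>w\<close> at the raised level, minus \<open>s\<close>, and both paths are read at the same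
  absolute time.\<close>

lemma trace_hits_shift:
  assumes w: "w \<in> borel_measurable borel" and U: "U \<in> sets borel" and s: "0 \<le> s" and t: "0 \<le> t"
  shows "trace_hits U (\<lambda>u. w (s + u)) t E \<longleftrightarrow> trace_hits U w (occ (visits U w) s + t) E"
proof -
  define C where "C = visits U w"
  define C' where "C' = visits U (\<lambda>u. w (s + u))"
  have C: "C \<in> sets borel" unfolding C_def by (rule visits_borel[OF w U])
  have "C' = {u. 0 \<le> u \<and> s + u \<in> C}" using s by (auto simp: C_def C'_def visits_def)
  then have occ': "occ C' u = occ C (s + u) - occ C s" if "0 \<le> u" for u
    using occ_shift[OF C s that] by simp
  show ?thesis
  proof (cases "inverse_clock (occ C) (occ C s + t) = \<infinity>")
    case True
    have "inverse_clock (occ C') t = \<infinity>" unfolding inverse_clock_infinite_iff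
    proof (intro allI impI)
      fix u :: real assume "0 < u"
      then show "occ C' u \<le> t" using True s occ'[of u] by (auto simp: inverse_clock_infinite_iff dest!: spec[of _ "s + u"])
    qed
    then show ?thesis using True by (simp add: trace_hits_def C_def C'_def)
  next
    case False
    have "0 \<le> occ C s + t" using t occ_nonneg[of C s] by simp
    from inverse_clock_occ[OF C False this] obtain b where
      b: "0 \<le> b" "inverse_clock (occ C) (occ C s + t) = ereal b" "\<And>u. occ C s + t < occ C u \<longleftrightarrow> b < u" by metis
    have "s \<le> b" using b(3)[of s] t by (cases "b < s") auto
    have "inverse_clock (occ C') t = ereal (b - s)"
    proof (rule inverse_clock_eqI)
      fix u :: real assume "0 < u"
      then show "t < occ C' u \<longleftrightarrow> b - s < u" using b(3)[of "s + u"] occ'[of u] by auto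
    qed (use \<open>s \<le> b\<close> in simp)
    then show ?thesis using b(2) by (simp add: trace_hits_def flip: C_def C'_def)
  qed
qed

lemma trace_hits_measurable:
  assumes [measurable]: "w \<in> borel_measurable borel" "U \<in> sets borel" "E \<in> sets borel"
  shows "{v. trace_hits U w v E} \<in> sets borel"
proof -
  have [measurable]: "visits U w \<in> sets borel" by (rule visits_borel) fact+
  have "{v \<in> space borel. trace_hits U w v E} \<in> sets borel"
    unfolding trace_hits_def by measurable
  then show ?thesis by simp
qed

text \<open>With \<open>v = occ C s\<close> the left side becomes the integral of \<open>H\<close>
  over the window from \<open>t\<close> to \<open>A + t\<close>. Over \<open>{0..A}\<close> the same
  substitution, read backwards, gives the time spent in \<open>U \<inter> E\<close>, since the
  inverse clock at the clock value of a visit returns that visit.\<close>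

lemma trace_hits_integral_le:
  assumes w: "w \<in> borel_measurable borel" "right_cont_path w" and U: "open U"
    and E: "E \<in> sets borel" and t: "0 \<le> t" and T: "0 \<le> T"
  defines "C \<equiv> visits U w"
  shows "(\<integral>\<^sup>+ s. indicator {s. trace_hits U (\<lambda>u. w (s + u)) t E} s * indicator (C \<inter> {0..T}) s \<partial>lborel)
     \<le> (\<integral>\<^sup>+ s. indicator (visits (U \<inter> E) w \<inter> {0..T}) s \<partial>lborel) + ennreal (min t (occ C T))"
proof -
  have Ub: "U \<in> sets borel" using U by simp
  have C: "C \<in> sets borel" unfolding C_def by (rule visits_borel[OF w(1) Ub])
  define H :: "real \<Rightarrow> ennreal" where "H = indicator {v. trace_hits U w v E}"
  have H[measurable]: "H \<in> borel_measurable borel"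
    unfolding H_def using trace_hits_measurable[OF w(1) Ub E] by simp
  define A where "A = occ C T"
  have A0: "0 \<le> A" by (simp add: A_def occ_nonneg)
  have "(\<integral>\<^sup>+ s. indicator {s. trace_hits U (\<lambda>u. w (s + u)) t E} s * indicator (C \<inter> {0..T}) s \<partial>lborel)
      = (\<integral>\<^sup>+ s. H (t + occ C s) * indicator (C \<inter> {0..T}) s \<partial>lborel)"
    by (rule nn_integral_cong)
      (auto simp: H_def C_def indicator_def trace_hits_shift[OF w(1) Ub _ t] add.commute)
  also have "\<dots> = (\<integral>\<^sup>+ v. H (t + v) * indicator {0..A} v \<partial>lborel)"
    unfolding A_def by (rule occ_change_of_variables[OF C T]) measurable
  also have "\<dots> = (\<integral>\<^sup>+ v. H (t + v) * indicator {t..A+t} (t + v) \<partial>lborel)"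
    by (rule nn_integral_cong) (auto simp: indicator_def)
  also have "\<dots> = (\<integral>\<^sup>+ v. H v * indicator {t..A+t} v \<partial>distr lborel borel (\<lambda>v. t + v))"
    by (subst nn_integral_distr) auto
  also have "\<dots> = (\<integral>\<^sup>+ v. H v * indicator {t..A+t} v \<partial>lborel)"
    by (simp add: lborel_distr_plus)
  \<comment> \<open>The window leaves \<open>{0..A}\<close> only in \<open>{max t A..A+t}\<close>,
    of length \<open>A + t - max t A = min t A\<close>, and \<open>H\<close> is at most 1.\<close>
  also have "\<dots> \<le> (\<integral>\<^sup>+ v. H v * indicator {0..A} v + indicator {max t A..A+t} v \<partial>lborel)"
    by (rule nn_integral_mono) (use t in \<open>auto simp: H_def indicator_def\<close>)
  also have "\<dots> = (\<integral>\<^sup>+ v. H v * indicator {0..A} v \<partial>lborel) + ennreal (min t A)"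
    using A0 t by (subst nn_integral_add) (auto simp: emeasure_lborel_Icc_eq max_def min_def)
  also have "(\<integral>\<^sup>+ v. H v * indicator {0..A} v \<partial>lborel) = (\<integral>\<^sup>+ s. H (occ C s) * indicator (C \<inter> {0..T}) s \<partial>lborel)"
    unfolding A_def by (rule occ_change_of_variables[OF C T H, symmetric])
  also have "\<dots> = (\<integral>\<^sup>+ s. indicator (visits (U \<inter> E) w \<inter> {0..T}) s \<partial>lborel)"
  proof (rule nn_integral_cong)
    fix s
    show "H (occ C s) * indicator (C \<inter> {0..T}) s = indicator (visits (U \<inter> E) w \<inter> {0..T}) s"
    proof (cases "s \<in> C")
      case True
      obtain e where e: "0 < e" "{s..<s+e} \<subseteq> C"
        using visits_right_open[OF w(2) U] True unfolding C_def by blast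
      have s: "0 \<le> s" using True by (simp add: C_def visits_def)
      have "trace_hits U w (occ C s) E \<longleftrightarrow> w s \<in> E"
        using inverse_clock_occ_self[OF C s e] by (simp add: trace_hits_def flip: C_def)
      then show ?thesis using True by (auto simp: H_def indicator_def visits_def C_def)
    qed (auto simp: C_def visits_def indicator_def)
  qed
  finally show ?thesis by (simp add: A_def)
qed

section \<open>Reduction of the two fast-forwardings to one time change\<close>

lemma set_integral_if: "(LINT z:{0..t}|lborel. (if P z then 1 else 0 :: real)) = measure lborel ({z. 0 \<le> z \<and> P z} \<inter> {0..t::real})"
proof -
  have "(LINT z:{0..t}|lborel. (if P z then 1 else 0 :: real)) = (LINT z|lborel. indicator ({z. 0 \<le> z \<and> P z} \<inter> {0..t}) z)"
    unfolding set_lebesgue_integral_def by (rule Bochner_Integration.integral_cong) (auto simp: indicator_def)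
  then show ?thesis by simp
qed

lemma clock_l_eq: "clock_l f = occ (visits {-1<..} f)"
  unfolding clock_l_def occ_def visits_def fun_eq_iff by (simp add: set_integral_if)

lemma clock_r_eq: "clock_r f = occ (visits {..<1} f)"
  unfolding clock_r_def occ_def visits_def fun_eq_iff by (simp add: set_integral_if)

lemma ennreal_occ: "C \<in> sets borel \<Longrightarrow> ennreal (occ C s) = (\<integral>\<^sup>+ v. indicator C v * indicator {0..s} v \<partial>lborel)"
  unfolding occ_def using emeasure_eq_measure2[OF finite_Icc_lborel[of C 0 s]]
  by (simp flip: indicator_inter_arith)

text \<open>The right clock run at the value of the left clock is the clock of the open interval:
  \<open>occ Cr (occ Cl s) = occ C s\<close>. Hence the inverse clocks compose in the reverse order,
  and the two deletions are a single time change.\<close>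

lemma N_r_N_l:
  assumes f: "f \<in> borel_measurable borel" "right_cont_path f"
  defines "C \<equiv> visits {-1<..<1} f"
  assumes fin: "\<And>t. 0 \<le> t \<Longrightarrow> inverse_clock (occ C) t \<noteq> \<infinity>"
  shows "NN_well_defined f" and "0 \<le> t \<Longrightarrow> N_r (N_l f) t = f (real_of_ereal (inverse_clock (occ C) t))"
proof -
  define Cl where "Cl = visits {-1<..} f"
  define Cr where "Cr = visits {..<1} (N_l f)"
  have cl: "clock_l f = occ Cl" by (simp add: Cl_def clock_l_eq)
  have cr: "clock_r (N_l f) = occ Cr" by (simp add: Cr_def clock_r_eq)
  have bC: "C \<in> sets borel" unfolding C_def by (rule visits_borel[OF f(1)]) simp
  have bCl[measurable]: "Cl \<in> sets borel" unfolding Cl_def by (rule visits_borel[OF f(1)]) simp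
  have "N_l f \<in> borel_measurable borel"
    unfolding N_l_def cl using f(1) by measurable
  then have bCr: "Cr \<in> sets borel" unfolding Cr_def by (rule visits_borel) simp
  have comp: "occ Cr (occ Cl s) = occ C s" if "0 \<le> s" for s
  proof -
    have "ennreal (occ Cr (occ Cl s)) = (\<integral>\<^sup>+ v. indicator Cr v * indicator {0..occ Cl s} v \<partial>lborel)"
      by (rule ennreal_occ[OF bCr])
    also have "\<dots> = (\<integral>\<^sup>+ r. indicator Cr (occ Cl r) * indicator (Cl \<inter> {0..s}) r \<partial>lborel)"
      by (rule occ_change_of_variables[symmetric, OF bCl that]) (use bCr in simp)
    also have "\<dots> = (\<integral>\<^sup>+ r. indicator C r * indicator {0..s} r \<partial>lborel)"
    proof (rule nn_integral_cong)
      fix r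
      show "indicator Cr (occ Cl r) * indicator (Cl \<inter> {0..s}) r = (indicator C r * indicator {0..s} r :: ennreal)"
      proof (cases "r \<in> Cl")
        case True
        then obtain e where e: "0 < e" "{r..<r+e} \<subseteq> Cl"
          using visits_right_open[OF f(2) open_greaterThan] unfolding Cl_def by metis
        have "0 \<le> r" using True by (simp add: Cl_def visits_def)
        \<comment> \<open>At a time \<open>r\<close> in \<open>Cl\<close> the path
          \<open>N_l f\<close> shows \<open>f r\<close> again at its own time
          \<open>occ Cl r\<close>, so testing it against 1 combines both constraints.\<close>
        then have "N_l f (occ Cl r) = f r"
          unfolding N_l_def cl using inverse_clock_occ_self[OF bCl _ e] by simp
        then have "occ Cl r \<in> Cr \<longleftrightarrow> r \<in> C"
          using True by (auto simp: Cr_def C_def Cl_def visits_def occ_nonneg)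
        then show ?thesis using True by (simp add: indicator_def)
      qed (auto simp: Cl_def C_def visits_def indicator_def)
    qed
    also have "\<dots> = ennreal (occ C s)" by (rule ennreal_occ[OF bC, symmetric])
    finally show ?thesis by (simp add: occ_nonneg)
  qed
  have le: "occ C s \<le> occ Cl s" for s
    unfolding occ_def by (rule measure_mono_fmeasurable)
      (use bC finite_Icc_lborel[OF bCl] in \<open>auto simp: C_def Cl_def visits_def\<close>)
  have finl: "inverse_clock (occ Cl) t \<noteq> \<infinity>" and finr: "inverse_clock (occ Cr) t \<noteq> \<infinity>" if t: "0 \<le> t" for t
  proof -
    obtain u where u: "0 < u" "t < occ C u" using fin[OF t] by (auto simp: inverse_clock_infinite_iff not_le)
    then show "inverse_clock (occ Cl) t \<noteq> \<infinity>"
      using le[of u] by (auto simp: inverse_clock_infinite_iff not_le intro!: exI[of _ u])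
    have "t < occ Cr (occ Cl u)" using u comp[of u] by simp
    moreover from this have "0 < occ Cl u" using t occ_nonpos[of "occ Cl u" Cr] by (cases "occ Cl u \<le> 0") auto
    ultimately show "inverse_clock (occ Cr) t \<noteq> \<infinity>"
      by (auto simp: inverse_clock_infinite_iff not_le)
  qed
  then show "NN_well_defined f" by (simp add: NN_well_defined_def cl cr)
  assume t: "0 \<le> t"
  obtain b where b: "0 \<le> b" "inverse_clock (occ Cr) t = ereal b" "\<And>u. t < occ Cr u \<longleftrightarrow> b < u"
    using inverse_clock_occ[OF bCr finr[OF t] t] by metis
  have "t < occ C u \<longleftrightarrow> b < occ Cl u" if "0 < u" for u
    using b(3)[of "occ Cl u"] comp[of u] that by simp
  then have "{s. 0 < s \<and> t < occ C s} = {s. 0 < s \<and> b < occ Cl s}" by blast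
  then have "inverse_clock (occ C) t = inverse_clock (occ Cl) b"
    by (simp add: inverse_clock_def)
  then show "N_r (N_l f) t = f (real_of_ereal (inverse_clock (occ C) t))"
    unfolding N_r_def cr b(2) by (simp add: N_l_def cl)
qed

section \<open>Path laws from stationary independent increments\<close>

text \<open>The product formula over a finite \<open>J\<close> is the one over its image under
  \<open>f\<close>, with the events relabelled by the inverse of \<open>f\<close>. Applied with
  successor maps, it drops the starting value from the independent family and renumbers the
  increments.\<close>

lemma (in prob_space) indep_vars_reindex:
  assumes "indep_vars M' X (f ` I)" "inj_on f I"
  shows "indep_vars (\<lambda>i. M' (f i)) (\<lambda>i. X (f i)) I"
proof -
  define F where "F i = {X i -` A \<inter> space M |A. A \<in> sets (M' i)}" for i
  have rv: "\<And>i. i \<in> I \<Longrightarrow> random_variable (M' (f i)) (X (f i))" and F: "indep_sets F (f ` I)"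
    using assms(1) by (simp_all add: indep_vars_def2 F_def[abs_def])
  have "indep_sets (\<lambda>i. F (f i)) I"
  proof (rule indep_setsI)
    show "F (f i) \<subseteq> events" if "i \<in> I" for i using F that by (simp add: indep_sets_def)
    fix A J assume J: "J \<noteq> {}" "J \<subseteq> I" "finite J" "\<forall>j\<in>J. A j \<in> F (f j)"
    have inj: "inj_on f J" using assms(2) J(2) by (rule inj_on_subset)
    have inv: "the_inv_into J f (f j) = j" if "j \<in> J" for j using the_inv_into_f_f[OF inj that] .
    have "prob (\<Inter>j\<in>f ` J. A (the_inv_into J f j)) = (\<Prod>j\<in>f ` J. prob (A (the_inv_into J f j)))"
      by (rule indep_setsD[OF F]) (use J inv in auto)
    then show "prob (\<Inter>j\<in>J. A j) = (\<Prod>j\<in>J. prob (A j))"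
      using inv by (simp add: prod.reindex[OF inj])
  qed
  then show ?thesis using rv by (simp add: indep_vars_def2 F_def)
qed

section \<open>Dyadic times and path skeletons\<close>

definition dyadics :: "real set" where "dyadics = {real k / 2 ^ n | k n. True}"

text \<open>For \<open>t \<ge> 0\<close> this is the first point of the grid of mesh
  \<open>1 / 2 ^ n\<close> strictly to the right of \<open>t\<close>; strictness makes the points
  approach \<open>t\<close> within \<open>at_right t\<close> even if \<open>t\<close> is itself
  dyadic.\<close>

definition dyadic_above :: "nat \<Rightarrow> real \<Rightarrow> real" where
  "dyadic_above n t = (real (nat \<lfloor>2 ^ n * max 0 t\<rfloor>) + 1) / 2 ^ n"

lemma dyadics_nonneg: "q \<in> dyadics \<Longrightarrow> 0 \<le> q"
  by (auto simp: dyadics_def)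

lemma dyadic_above_in: "dyadic_above n t \<in> dyadics"
  unfolding dyadics_def dyadic_above_def mem_Collect_eq
  by (intro exI[of _ "Suc (nat \<lfloor>2 ^ n * max 0 t\<rfloor>)"] exI[of _ n]) simp

lemma dyadic_above_bounds:
  assumes "0 \<le> t" shows "t < dyadic_above n t" "dyadic_above n t \<le> t + (1/2) ^ n"
proof -
  have "real (nat \<lfloor>2 ^ n * t\<rfloor>) = real_of_int \<lfloor>2 ^ n * t\<rfloor>" using assms by simp
  then have e: "dyadic_above n t = (real_of_int \<lfloor>2 ^ n * t\<rfloor> + 1) / 2 ^ n"
    using assms by (simp add: dyadic_above_def max_def)
  show "t < dyadic_above n t" unfolding e
    using floor_correct[of "2 ^ n * t"] by (simp add: field_simps)
  show "dyadic_above n t \<le> t + (1/2) ^ n" unfolding e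
    using floor_correct[of "2 ^ n * t"] by (simp add: field_simps power_divide)
qed

lemma dyadic_above_tendsto:
  assumes "0 \<le> t" shows "filterlim (\<lambda>n. dyadic_above n t) (at_right t) sequentially"
proof -
  have upper: "(\<lambda>n. t + (1/2::real) ^ n) \<longlonglongrightarrow> t"
    using tendsto_add[OF tendsto_const[of t] LIMSEQ_power_zero[of "1/2 :: real"]] by simp
  have "(\<lambda>n. dyadic_above n t) \<longlonglongrightarrow> t"
    by (rule real_tendsto_sandwich[OF _ _ tendsto_const upper])
      (simp_all add: dyadic_above_bounds[OF assms] less_imp_le)
  then show ?thesis
    unfolding filterlim_at using dyadic_above_bounds(1)[OF assms] by (auto simp: less_imp_neq[symmetric])
qed

lemma right_cont_dyadic_limit:
  assumes "right_cont_path w" "0 \<le> t"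
  shows "(\<lambda>n. w (dyadic_above n t)) \<longlonglongrightarrow> w t"
proof -
  have "(w \<longlongrightarrow> w t) (at_right t)" using assms by (simp add: right_cont_path_def continuous_within)
  then show ?thesis by (rule filterlim_compose[OF _ dyadic_above_tendsto[OF assms(2)]])
qed

text \<open>\<open>dyadic_above n\<close> takes countably many values, so joint measurability
  follows from measurability of \<open>F\<close> at each of them.\<close>

lemma dyadic_sample_measurable:
  assumes "\<And>q. q \<in> dyadics \<Longrightarrow> F q \<in> borel_measurable N"
  shows "(\<lambda>(t, x). F (dyadic_above n t) x) \<in> borel_measurable (borel \<Otimes>\<^sub>M N)"
proof -
  have "(real k + 1) / 2 ^ n \<in> dyadics" for k
    unfolding dyadics_def mem_Collect_eq by (intro exI[of _ "Suc k"] exI[of _ n]) simp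
  then have [measurable]: "F ((real k + 1) / 2 ^ n) \<in> borel_measurable N" for k by (rule assms)
  have f: "(\<lambda>x. F ((real k + 1) / 2 ^ n) (snd x)) \<in> borel_measurable (borel \<Otimes>\<^sub>M N)" for k
    by measurable
  have g: "(\<lambda>x. nat \<lfloor>2 ^ n * max 0 (fst x :: real)\<rfloor>) \<in> measurable (borel \<Otimes>\<^sub>M N) (count_space UNIV)"
    by measurable
  from measurable_compose_countable[OF f g]
  show ?thesis unfolding dyadic_above_def case_prod_beta .
qed

text \<open>Laws of paths are compared on the product of Borel algebras over the dyadic times: a
  right-continuous path is a measurable function of its dyadic skeleton, jointly with time.\<close>

definition skeleton_path :: "(real \<Rightarrow> real) \<Rightarrow> real \<Rightarrow> real" where
  "skeleton_path z t = lim (\<lambda>n. z (dyadic_above n t))"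

abbreviation skeletons :: "(real \<Rightarrow> real) measure" where
  "skeletons \<equiv> \<Pi>\<^sub>M q\<in>dyadics. (borel :: real measure)"

lemma skeleton_path_measurable [measurable]:
  "(\<lambda>(t, z). skeleton_path z t) \<in> borel_measurable (borel \<Otimes>\<^sub>M skeletons)"
proof -
  have [measurable]: "(\<lambda>x. (snd x) (dyadic_above n (fst x))) \<in> borel_measurable (borel \<Otimes>\<^sub>M skeletons)" for n
    using dyadic_sample_measurable[of "\<lambda>q z. z q" skeletons n, OF measurable_component_singleton]
    unfolding case_prod_beta .
  show ?thesis unfolding skeleton_path_def case_prod_beta by measurable
qed

lemma finite_dyadics_common_grid:
  assumes "finite J" "J \<subseteq> dyadics"
  obtains n k N where "\<And>q. q \<in> J \<Longrightarrow> q = real (k q) / 2 ^ n" "\<And>q. q \<in> J \<Longrightarrow> k q \<le> N"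
proof -
  have "\<forall>q\<in>J. \<exists>k n. q = real k / 2 ^ n" using assms(2) by (auto simp: dyadics_def)
  then obtain k m where km: "\<And>q. q \<in> J \<Longrightarrow> q = real (k q) / 2 ^ m q" by metis
  define n where "n = Max (insert 0 (m ` J))"
  define k' where "k' q = k q * 2 ^ (n - m q)" for q
  have 1: "q = real (k' q) / 2 ^ n" if q: "q \<in> J" for q
  proof -
    have "m q \<le> n" using q assms(1) by (simp add: n_def)
    then have "(2::real) ^ n = 2 ^ m q * 2 ^ (n - m q)" by (simp flip: power_add)
    then have "real (k' q) / 2 ^ n = real (k q) / 2 ^ m q" by (simp add: k'_def)
    then show ?thesis using km[OF q] by simp
  qed
  have "k' q \<le> Max (insert 0 (k' ` J))" if "q \<in> J" for q using that assms(1) by simp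
  then show ?thesis using that 1 by blast
qed

section \<open>The process and its shifted increment paths\<close>

locale levy_from =
  fixes \<mu> :: "real measure" and M :: "'a measure" and Y :: "real \<Rightarrow> 'a \<Rightarrow> real"
  assumes levy: "levy_process_from \<mu> M Y"
begin

sublocale prob_space M
  using levy by (simp add: levy_process_from_def)

lemma Y_measurable [measurable]: "0 \<le> t \<Longrightarrow> Y t \<in> borel_measurable M"
  using levy by (simp add: levy_process_from_def)

lemma distr_Y0: "distr M borel (Y 0) = \<mu>"
  using levy by (simp add: levy_process_from_def)

lemma increments_indep:
  assumes "\<tau> 0 = 0" "\<And>i. i < n \<Longrightarrow> \<tau> i < \<tau> (Suc i)"
  shows "indep_vars (\<lambda>_. borel)
          (\<lambda>i \<omega>. if i = 0 then Y 0 \<omega> else Y (\<tau> i) \<omega> - Y (\<tau> (i - 1)) \<omega>) {..n::nat}"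
  using levy assms by (simp add: levy_process_from_def)

lemma increments_stationary:
  assumes "0 \<le> s" "0 \<le> t"
  shows "distr M borel (\<lambda>\<omega>. Y (s + t) \<omega> - Y s \<omega>) = distr M borel (\<lambda>\<omega>. Y t \<omega> - Y 0 \<omega>)"
  using levy assms by (simp add: levy_process_from_def)

lemma right_cont_Y: "\<omega> \<in> space M \<Longrightarrow> right_cont_path (\<lambda>t. Y t \<omega>)"
  using levy by (simp add: levy_process_from_def cadlag_def right_cont_path_def)

text \<open>The samples at \<open>dyadic_above n t\<close> are jointly measurable and converge by
  right-continuity; \<open>dyadic_above\<close> clamps negative times to 0 in the same way as the
  statement.\<close>

lemma Y_joint_measurable: "(\<lambda>(t, \<omega>). Y (max 0 t) \<omega>) \<in> borel_measurable (borel \<Otimes>\<^sub>M M)"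
proof -
  have m: "(\<lambda>(t, \<omega>). Y (dyadic_above n t) \<omega>) \<in> borel_measurable (borel \<Otimes>\<^sub>M M)" for n
    by (rule dyadic_sample_measurable) (auto dest: dyadics_nonneg)
  show ?thesis
  proof (rule borel_measurable_LIMSEQ_metric[OF m])
    fix x assume x: "x \<in> space (borel \<Otimes>\<^sub>M M :: (real \<times> 'a) measure)"
    have "dyadic_above n (max 0 t) = dyadic_above n t" for n t by (simp add: dyadic_above_def)
    then have "(\<lambda>n. Y (dyadic_above n (fst x)) (snd x)) \<longlonglongrightarrow> Y (max 0 (fst x)) (snd x)"
      using right_cont_dyadic_limit[OF right_cont_Y, of "snd x" "max 0 (fst x)"] x
      by (auto simp: space_pair_measure)
    then show "(\<lambda>n. case x of (t, \<omega>) \<Rightarrow> Y (dyadic_above n t) \<omega>) \<longlonglongrightarrow> (case x of (t, \<omega>) \<Rightarrow> Y (max 0 t) \<omega>)"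
      by (simp add: case_prod_beta)
  qed
qed

lemma Y_pos_measurable [measurable (raw)]:
  assumes [measurable]: "f \<in> borel_measurable N" "g \<in> measurable N M"
  shows "(\<lambda>x. Y (max 0 (f x)) (g x)) \<in> borel_measurable N"
proof -
  have "(\<lambda>x. (f x, g x)) \<in> measurable N (borel \<Otimes>\<^sub>M M)" by measurable
  from measurable_compose[OF this Y_joint_measurable] show ?thesis by simp
qed

text \<open>The path of increments after time \<open>s\<close>, recorded at dyadic times. Clamping
  has an effect only for negative \<open>s\<close>, where it secures measurability in
  \<open>s\<close> over the whole line.\<close>

definition shifted_skeleton :: "real \<Rightarrow> 'a \<Rightarrow> real \<Rightarrow> real" where
  "shifted_skeleton s \<omega> = (\<lambda>q\<in>dyadics. Y (max 0 (s + q)) \<omega> - Y (max 0 s) \<omega>)"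

lemma shifted_skeleton_measurable [measurable (raw)]:
  assumes [measurable]: "f \<in> borel_measurable N" "g \<in> measurable N M"
  shows "(\<lambda>x. shifted_skeleton (f x) (g x)) \<in> measurable N skeletons"
  unfolding shifted_skeleton_def by measurable

lemma skeleton_path_shifted:
  assumes "\<omega> \<in> space M" "0 \<le> s" "0 \<le> t"
  shows "skeleton_path (shifted_skeleton s \<omega>) t = Y (s + t) \<omega> - Y s \<omega>"
proof -
  have "(\<lambda>n. Y (s + dyadic_above n t) \<omega>) \<longlonglongrightarrow> Y (s + t) \<omega>"
  proof -
    have "((\<lambda>t. Y t \<omega>) \<longlongrightarrow> Y (s + t) \<omega>) (at_right (s + t))"
      using right_cont_Y[OF assms(1)] assms(2,3) by (simp add: right_cont_path_def continuous_within)
    moreover have "filterlim (\<lambda>n. s + dyadic_above n t) (at_right (s + t)) sequentially"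
      using dyadic_above_tendsto[OF assms(3)] unfolding filterlim_at
      by (auto intro!: tendsto_intros)
    ultimately show ?thesis by (rule filterlim_compose)
  qed
  then have "(\<lambda>n. shifted_skeleton s \<omega> (dyadic_above n t)) \<longlonglongrightarrow> Y (s + t) \<omega> - Y s \<omega>"
    using assms dyadics_nonneg[OF dyadic_above_in]
    by (auto simp: shifted_skeleton_def dyadic_above_in intro!: tendsto_diff)
  then show ?thesis unfolding skeleton_path_def by (rule limI)
qed

section \<open>Stationarity of the increment skeleton\<close>

lemma grid_increments_indep:
  assumes "0 \<le> s" "0 < h"
  shows "indep_vars (\<lambda>_. borel) (\<lambda>i \<omega>. Y (s + real (Suc i) * h) \<omega> - Y (s + real i * h) \<omega>) {..<N}"
proof (cases "s = 0")
  case True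
  define \<tau> where "\<tau> i = real i * h" for i :: nat
  have "indep_vars (\<lambda>_. borel) (\<lambda>i \<omega>. if i = 0 then Y 0 \<omega> else Y (\<tau> i) \<omega> - Y (\<tau> (i - 1)) \<omega>) {..N}"
    by (rule increments_indep) (use assms in \<open>auto simp: \<tau>_def\<close>)
  then have "indep_vars (\<lambda>_. borel) (\<lambda>i \<omega>. if i = 0 then Y 0 \<omega> else Y (\<tau> i) \<omega> - Y (\<tau> (i - 1)) \<omega>) (Suc ` {..<N})"
    by (rule indep_vars_subset) auto
  from indep_vars_reindex[OF this] show ?thesis by (simp add: \<tau>_def True)
next
  case False
  \<comment> \<open>The partition starts at 0 and has \<open>s\<close> as its first positive node,
    so the grid increments begin at index 2. For \<open>s = 0\<close> it would not be strictly
    increasing, hence the separate case.\<close>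
  define \<tau> where "\<tau> i = (if i = 0 then 0 else s + real (i - 1) * h)" for i :: nat
  have "indep_vars (\<lambda>_. borel) (\<lambda>i \<omega>. if i = 0 then Y 0 \<omega> else Y (\<tau> i) \<omega> - Y (\<tau> (i - 1)) \<omega>) {..Suc N}"
  proof (rule increments_indep)
    fix i show "\<tau> i < \<tau> (Suc i)" using assms False by (cases i) (auto simp: \<tau>_def)
  qed (simp add: \<tau>_def)
  then have "indep_vars (\<lambda>_. borel) (\<lambda>i \<omega>. if i = 0 then Y 0 \<omega> else Y (\<tau> i) \<omega> - Y (\<tau> (i - 1)) \<omega>)
    ((\<lambda>i. Suc (Suc i)) ` {..<N})"
    by (rule indep_vars_subset) auto
  from indep_vars_reindex[OF this] show ?thesis by (simp add: \<tau>_def inj_on_def)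
qed

definition grid_increments :: "real \<Rightarrow> real \<Rightarrow> nat \<Rightarrow> 'a \<Rightarrow> nat \<Rightarrow> real" where
  "grid_increments s h N \<omega> = (\<lambda>i\<in>{..<N}. Y (s + real (Suc i) * h) \<omega> - Y (s + real i * h) \<omega>)"

lemma grid_increments_measurable [measurable]:
  assumes "0 \<le> s" "0 < h"
  shows "grid_increments s h N \<in> measurable M (\<Pi>\<^sub>M i\<in>{..<N}. borel)"
  unfolding grid_increments_def
  by (intro measurable_restrict borel_measurable_diff Y_measurable) (use assms in auto)

lemma distr_grid_increments:
  assumes "0 \<le> s" "0 < h" "0 < N"
  shows "distr M (\<Pi>\<^sub>M i\<in>{..<N}. borel) (grid_increments s h N) =
    (\<Pi>\<^sub>M i\<in>{..<N}. distr M borel (\<lambda>\<omega>. Y h \<omega> - Y 0 \<omega>))"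
proof -
  have "distr M (\<Pi>\<^sub>M i\<in>{..<N}. borel) (grid_increments s h N) =
    (\<Pi>\<^sub>M i\<in>{..<N}. distr M borel (\<lambda>\<omega>. Y (s + real (Suc i) * h) \<omega> - Y (s + real i * h) \<omega>))"
    unfolding grid_increments_def
    by (subst indep_vars_iff_distr_eq_PiM'[symmetric])
      (use assms grid_increments_indep[OF assms(1,2)] in auto)
  moreover have "distr M borel (\<lambda>\<omega>. Y (s + real (Suc i) * h) \<omega> - Y (s + real i * h) \<omega>) = distr M borel (\<lambda>\<omega>. Y h \<omega> - Y 0 \<omega>)" for i
    using increments_stationary[of "s + real i * h" h] assms by (simp add: algebra_simps)
  ultimately show ?thesis by simp
qed

text \<open>Each value of the skeleton on the grid is a telescoping sum of grid increments, which
  turns a cylinder event into an event about finitely many independent increments.\<close>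

lemma skeleton_cylinder:
  assumes J: "\<And>q. q \<in> J \<Longrightarrow> q = real (k q) / 2 ^ n" "\<And>q. q \<in> J \<Longrightarrow> k q < N"
    and sub: "J \<subseteq> dyadics" and s: "0 \<le> s"
  shows "shifted_skeleton s \<omega> \<in> prod_emb dyadics (\<lambda>_. borel) J (Pi\<^sub>E J A)
    \<longleftrightarrow> (\<forall>q\<in>J. (\<Sum>i<k q. grid_increments s (1 / 2 ^ n) N \<omega> i) \<in> A q)"
proof -
  have "(\<Sum>i<k q. grid_increments s (1 / 2 ^ n) N \<omega> i) = shifted_skeleton s \<omega> q" if q: "q \<in> J" for q
  proof -
    have "(\<Sum>i<k q. grid_increments s (1 / 2 ^ n) N \<omega> i) =
      (\<Sum>i<k q. Y (s + real (Suc i) * (1 / 2 ^ n)) \<omega> - Y (s + real i * (1 / 2 ^ n)) \<omega>)"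
      by (rule sum.cong) (use J(2)[OF q] in \<open>auto simp: grid_increments_def\<close>)
    also have "\<dots> = Y (s + real (k q) * (1 / 2 ^ n)) \<omega> - Y (s + real 0 * (1 / 2 ^ n)) \<omega>"
      by (rule sum_lessThan_telescope)
    also have "\<dots> = shifted_skeleton s \<omega> q"
      using J(1)[OF q] sub q s dyadics_nonneg[of q] by (auto simp: shifted_skeleton_def max_def)
    finally show ?thesis .
  qed
  moreover have "shifted_skeleton s \<omega> \<in> prod_emb dyadics (\<lambda>_. borel) J (Pi\<^sub>E J A)
      \<longleftrightarrow> (\<forall>q\<in>J. shifted_skeleton s \<omega> q \<in> A q)"
  proof -
    have "dyadics \<inter> J = J" using sub by blast
    moreover have "shifted_skeleton s \<omega> q = Y (max 0 (s + q)) \<omega> - Y (max 0 s) \<omega>" if "q \<in> J" for q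
      using sub that by (auto simp: shifted_skeleton_def)
    ultimately show ?thesis
      by (simp add: prod_emb_iff shifted_skeleton_def restrict_PiE_iff Pi_iff)
  qed
  ultimately show ?thesis by simp
qed

lemma cylinder_in_sets:
  assumes "finite J" "J \<subseteq> dyadics" "\<And>q. q \<in> J \<Longrightarrow> A q \<in> sets borel"
  shows "prod_emb dyadics (\<lambda>_. borel) J (Pi\<^sub>E J A) \<in> sets skeletons"
  using assms by (intro sets_PiM_I) auto

lemma grid_event_in_sets:
  fixes N :: nat
  assumes "finite J" "\<And>q. q \<in> J \<Longrightarrow> A q \<in> sets borel" "\<And>q. q \<in> J \<Longrightarrow> k q < N"
  shows "{d \<in> space (\<Pi>\<^sub>M i\<in>{..<N}. borel :: real measure). \<forall>q\<in>J. (\<Sum>i<k q. d i) \<in> A q} \<in> sets (\<Pi>\<^sub>M i\<in>{..<N}. borel)"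
proof -
  have "{d \<in> space (\<Pi>\<^sub>M i\<in>{..<N}. borel :: real measure). (\<Sum>i<k q. d i) \<in> A q} \<in> sets (\<Pi>\<^sub>M i\<in>{..<N}. borel)"
    if q: "q \<in> J" for q
  proof -
    have "(\<lambda>d. \<Sum>i<k q. d i) \<in> borel_measurable (\<Pi>\<^sub>M i\<in>{..<N}. borel :: real measure)"
    proof -
      have "(\<lambda>d. d i) \<in> borel_measurable (\<Pi>\<^sub>M i\<in>{..<N}. borel :: real measure)" if "i \<in> {..<k q}" for i
        by (rule measurable_component_singleton) (use that assms(3)[OF q] in auto)
      from borel_measurable_sum[of "{..<k q}" "\<lambda>i d. d i", OF this] show ?thesis by simp
    qed
    from measurable_sets[OF this assms(2)[OF q]] show ?thesis
      by (simp add: vimage_def Int_def conj_commute)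
  qed
  then show ?thesis by (rule sets.sets_Collect_finite_All) (simp_all add: assms(1))
qed

text \<open>A finite measure on the product space is determined by cylinders. Finitely many dyadic
  times lie on a common grid, and there the increments are i.i.d. with a law that does not involve
  \<open>s\<close>.\<close>

lemma distr_shifted_skeleton:
  assumes s: "0 \<le> s"
  shows "distr M skeletons (shifted_skeleton s) = distr M skeletons (shifted_skeleton 0)"
proof (rule measure_eqI_PiM_infinite)
  show "finite_measure (distr M skeletons (shifted_skeleton s))"
    by (intro finite_measure_distr) measurable
  fix A :: "real \<Rightarrow> real set" and J assume J: "finite J" "J \<subseteq> dyadics" "\<And>q. q \<in> J \<Longrightarrow> A q \<in> sets borel"
  obtain n k N' where k: "\<And>q. q \<in> J \<Longrightarrow> q = real (k q) / 2 ^ n" "\<And>q. q \<in> J \<Longrightarrow> k q \<le> N'"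
    using finite_dyadics_common_grid[OF J(1,2)] by metis
  \<comment> \<open>The successor keeps \<open>N\<close> positive even for empty \<open>J\<close>,
    as \<open>distr_grid_increments\<close> requires.\<close>
  define N where "N = Suc N'"
  have kN: "\<And>q. q \<in> J \<Longrightarrow> k q < N" using k(2) by (auto simp: N_def less_Suc_eq_le)
  define B where "B = {d \<in> space (\<Pi>\<^sub>M i\<in>{..<N}. borel :: real measure). \<forall>q\<in>J. (\<Sum>i<k q. d i) \<in> A q}"
  have B: "B \<in> sets (\<Pi>\<^sub>M i\<in>{..<N}. borel)" unfolding B_def by (rule grid_event_in_sets) (use J kN in auto)
  have "emeasure (distr M skeletons (shifted_skeleton r)) (prod_emb dyadics (\<lambda>_. borel) J (Pi\<^sub>E J A))
    = emeasure (\<Pi>\<^sub>M i\<in>{..<N}. distr M borel (\<lambda>\<omega>. Y (1 / 2 ^ n) \<omega> - Y 0 \<omega>)) B" if r: "0 \<le> r" for r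
  proof -
    have m: "grid_increments r (1 / 2 ^ n) N \<in> measurable M (\<Pi>\<^sub>M i\<in>{..<N}. borel)"
      by (rule grid_increments_measurable) (use r in auto)
    have "emeasure (distr M skeletons (shifted_skeleton r)) (prod_emb dyadics (\<lambda>_. borel) J (Pi\<^sub>E J A))
      = emeasure M (shifted_skeleton r -` prod_emb dyadics (\<lambda>_. borel) J (Pi\<^sub>E J A) \<inter> space M)"
      by (rule emeasure_distr) (use cylinder_in_sets[OF J] in auto)
    also have "shifted_skeleton r -` prod_emb dyadics (\<lambda>_. borel) J (Pi\<^sub>E J A) \<inter> space M
      = grid_increments r (1 / 2 ^ n) N -` B \<inter> space M"
      using skeleton_cylinder[OF k(1) kN J(2) r] measurable_space[OF m] by (auto simp: B_def)
    also have "emeasure M \<dots> = emeasure (distr M (\<Pi>\<^sub>M i\<in>{..<N}. borel) (grid_increments r (1 / 2 ^ n) N)) B"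
      by (rule emeasure_distr[symmetric, OF m B])
    also have "\<dots> = emeasure (\<Pi>\<^sub>M i\<in>{..<N}. distr M borel (\<lambda>\<omega>. Y (1 / 2 ^ n) \<omega> - Y 0 \<omega>)) B"
      by (subst distr_grid_increments) (use r in \<open>auto simp: N_def\<close>)
    finally show ?thesis .
  qed
  from this[OF s] this[of 0] show "emeasure (distr M skeletons (shifted_skeleton s)) (prod_emb dyadics (\<lambda>_. borel) J (Pi\<^sub>E J A))
    = emeasure (distr M skeletons (shifted_skeleton 0)) (prod_emb dyadics (\<lambda>_. borel) J (Pi\<^sub>E J A))"
    by simp
qed simp_all

text \<open>The independent family supplied by \<open>increments_indep\<close> is split into the
  block \<open>{0}\<close>, which holds the starting value, and the block of increments.\<close>

lemma Y0_grid_independent: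
  assumes h: "0 < h" and A: "A \<in> sets borel" and G: "G \<in> sets (\<Pi>\<^sub>M i\<in>{..<N}. borel)"
  shows "emeasure M {\<omega> \<in> space M. Y 0 \<omega> \<in> A \<and> grid_increments 0 h N \<omega> \<in> G}
    = emeasure \<mu> A * emeasure M {\<omega> \<in> space M. grid_increments 0 h N \<omega> \<in> G}"
proof -
  define \<tau> where "\<tau> i = real i * h" for i :: nat
  define X where "X i \<omega> = (if i = 0 then Y 0 \<omega> else Y (\<tau> i) \<omega> - Y (\<tau> (i - 1)) \<omega>)" for i \<omega>
  define V where "V \<omega> = (\<lambda>i\<in>{0::nat}. X i \<omega>)" for \<omega>
  have "indep_vars (\<lambda>_. borel) X {..N}"
    unfolding X_def by (rule increments_indep) (use h in \<open>auto simp: \<tau>_def\<close>)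
  then have "indep_var (\<Pi>\<^sub>M i\<in>{0}. borel) V (\<Pi>\<^sub>M i\<in>{1..N}. borel) (\<lambda>\<omega>. \<lambda>i\<in>{1..N}. X i \<omega>)"
    unfolding V_def by (rule indep_var_restrict) auto
  then have "indep_var (\<Pi>\<^sub>M i\<in>{0}. borel) ((\<lambda>d. d) \<circ> V)
    (\<Pi>\<^sub>M i\<in>{..<N}. borel) ((\<lambda>d. \<lambda>i\<in>{..<N}. d (Suc i)) \<circ> (\<lambda>\<omega>. \<lambda>i\<in>{1..N}. X i \<omega>))"
    by (rule indep_var_compose) (auto intro!: measurable_restrict measurable_component_singleton)
  moreover have "(\<lambda>d. \<lambda>i\<in>{..<N}. d (Suc i)) \<circ> (\<lambda>\<omega>. \<lambda>i\<in>{1..N}. X i \<omega>) = grid_increments 0 h N"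
    by (auto simp: X_def grid_increments_def \<tau>_def fun_eq_iff)
  ultimately have ind: "indep_var (\<Pi>\<^sub>M i\<in>{0}. borel) V (\<Pi>\<^sub>M i\<in>{..<N}. borel) (grid_increments 0 h N)"
    by (simp add: comp_def)
  define A' where "A' = {d \<in> space (\<Pi>\<^sub>M i\<in>{0::nat}. borel :: real measure). d 0 \<in> A}"
  have A': "A' \<in> sets (\<Pi>\<^sub>M i\<in>{0::nat}. borel)"
    unfolding A'_def using A by measurable
  have V: "V \<omega> \<in> A' \<longleftrightarrow> Y 0 \<omega> \<in> A" for \<omega>
    by (auto simp: A'_def V_def X_def space_PiM PiE_def)
  have "prob ((\<lambda>\<omega>. (V \<omega>, grid_increments 0 h N \<omega>)) -` (A' \<times> G) \<inter> space M)
    = prob (V -` A' \<inter> space M) * prob (grid_increments 0 h N -` G \<inter> space M)"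
    by (rule indep_varD[OF ind A' G])
  moreover have "(\<lambda>\<omega>. (V \<omega>, grid_increments 0 h N \<omega>)) -` (A' \<times> G) \<inter> space M
    = {\<omega> \<in> space M. Y 0 \<omega> \<in> A \<and> grid_increments 0 h N \<omega> \<in> G}" using V by auto
  moreover have "V -` A' \<inter> space M = Y 0 -` A \<inter> space M" using V by auto
  moreover have "grid_increments 0 h N -` G \<inter> space M = {\<omega> \<in> space M. grid_increments 0 h N \<omega> \<in> G}" by auto
  moreover have "emeasure \<mu> A = emeasure M (Y 0 -` A \<inter> space M)"
    unfolding distr_Y0[symmetric] using A by (subst emeasure_distr) auto
  ultimately show ?thesis by (simp add: emeasure_eq_measure ennreal_mult)
qed

text \<open>For fixed \<open>A\<close> both sides are finite measures in \<open>S\<close>, so it is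
  enough to compare them on cylinders, which are events about grid increments.\<close>

lemma distr_Y0_skeleton:
  "distr M (borel \<Otimes>\<^sub>M skeletons) (\<lambda>\<omega>. (Y 0 \<omega>, shifted_skeleton 0 \<omega>))
    = \<mu> \<Otimes>\<^sub>M distr M skeletons (shifted_skeleton 0)"
proof -
  have m0[measurable]: "Y 0 \<in> borel_measurable M" by simp
  have mK[measurable]: "shifted_skeleton 0 \<in> measurable M skeletons" by measurable
  have eq: "emeasure M {\<omega> \<in> space M. Y 0 \<omega> \<in> A \<and> shifted_skeleton 0 \<omega> \<in> S}
     = emeasure \<mu> A * emeasure (distr M skeletons (shifted_skeleton 0)) S"
    if A[measurable]: "A \<in> sets borel" and S: "S \<in> sets skeletons" for A S
  proof -
    \<comment> \<open>The unnormalised law of the skeleton on the event \<open>Y 0 \<in> A\<close>;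
      conditioning would mean dividing by a probability that may be 0.\<close>
    define P where "P = distr (density M (indicator (Y 0 -` A \<inter> space M))) skeletons (shifted_skeleton 0)"
    define Q where "Q = scale_measure (emeasure \<mu> A) (distr M skeletons (shifted_skeleton 0))"
    have A'[measurable]: "Y 0 -` A \<inter> space M \<in> sets M" by measurable
    have P: "emeasure P S = emeasure M {\<omega> \<in> space M. Y 0 \<omega> \<in> A \<and> shifted_skeleton 0 \<omega> \<in> S}"
      if [measurable]: "S \<in> sets skeletons" for S
    proof -
      have [measurable]: "shifted_skeleton 0 -` S \<inter> space M \<in> sets M" by measurable
      have "emeasure P S = emeasure (density M (indicator (Y 0 -` A \<inter> space M))) (shifted_skeleton 0 -` S \<inter> space M)"
        unfolding P_def by (subst emeasure_distr) auto
      also have "\<dots> = emeasure M ((Y 0 -` A \<inter> space M) \<inter> (shifted_skeleton 0 -` S \<inter> space M))"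
        by (subst emeasure_density) (auto simp flip: indicator_inter_arith)
      also have "(Y 0 -` A \<inter> space M) \<inter> (shifted_skeleton 0 -` S \<inter> space M)
        = {\<omega> \<in> space M. Y 0 \<omega> \<in> A \<and> shifted_skeleton 0 \<omega> \<in> S}" by auto
      finally show ?thesis .
    qed
    have "P = Q"
    proof (rule measure_eqI_PiM_infinite)
      show "finite_measure P"
        using P[of "space skeletons"] by (intro finite_measureI) (simp add: P_def)
      fix B :: "real \<Rightarrow> real set" and J assume J: "finite J" "J \<subseteq> dyadics" "\<And>q. q \<in> J \<Longrightarrow> B q \<in> sets borel"
      obtain n k N' where k: "\<And>q. q \<in> J \<Longrightarrow> q = real (k q) / 2 ^ n" "\<And>q. q \<in> J \<Longrightarrow> k q \<le> N'"
        using finite_dyadics_common_grid[OF J(1,2)] by metis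
      define N where "N = Suc N'"
      have kN: "\<And>q. q \<in> J \<Longrightarrow> k q < N" using k(2) by (auto simp: N_def less_Suc_eq_le)
      define G where "G = {d \<in> space (\<Pi>\<^sub>M i\<in>{..<N}. borel :: real measure). \<forall>q\<in>J. (\<Sum>i<k q. d i) \<in> B q}"
      have G: "G \<in> sets (\<Pi>\<^sub>M i\<in>{..<N}. borel)" unfolding G_def by (rule grid_event_in_sets) (use J kN in auto)
      define C where "C = prod_emb dyadics (\<lambda>_. borel :: real measure) J (Pi\<^sub>E J B)"
      have C: "C \<in> sets skeletons" unfolding C_def by (rule cylinder_in_sets[OF J])
      define D where "D = grid_increments 0 (1 / 2 ^ n) N"
      have D: "D \<in> measurable M (\<Pi>\<^sub>M i\<in>{..<N}. borel)"
        unfolding D_def by (rule grid_increments_measurable) auto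
      have CG: "shifted_skeleton 0 \<omega> \<in> C \<longleftrightarrow> D \<omega> \<in> G" if "\<omega> \<in> space M" for \<omega>
        using skeleton_cylinder[OF k(1) kN J(2), of 0 \<omega> B] measurable_space[OF D that]
        by (auto simp: C_def G_def D_def)
      have "emeasure P C = emeasure M {\<omega> \<in> space M. Y 0 \<omega> \<in> A \<and> D \<omega> \<in> G}"
        unfolding P[OF C] using CG by (intro arg_cong[where f = "emeasure M"]) auto
      also have "\<dots> = emeasure \<mu> A * emeasure M {\<omega> \<in> space M. D \<omega> \<in> G}"
        unfolding D_def by (rule Y0_grid_independent[OF _ A G]) simp
      also have "emeasure M {\<omega> \<in> space M. D \<omega> \<in> G} = emeasure (distr M skeletons (shifted_skeleton 0)) C"
        using C CG by (subst emeasure_distr) (auto intro!: arg_cong[where f = "emeasure M"])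
      finally show "emeasure P (prod_emb dyadics (\<lambda>_. borel) J (Pi\<^sub>E J B)) = emeasure Q (prod_emb dyadics (\<lambda>_. borel) J (Pi\<^sub>E J B))"
        by (simp add: Q_def C_def)
    qed (simp_all add: P_def Q_def)
    then show ?thesis using P[OF S] by (simp add: Q_def)
  qed
  have pm: "prob_space \<mu>" unfolding distr_Y0[symmetric] by (rule prob_space_distr) simp
  have pK: "prob_space (distr M skeletons (shifted_skeleton 0))" by (rule prob_space_distr) measurable
  have s\<mu>: "sets \<mu> = sets borel" by (simp flip: distr_Y0)
  show ?thesis
  proof (rule pair_measure_eqI[symmetric])
    show "sigma_finite_measure \<mu>" by (rule prob_space_imp_sigma_finite[OF pm])
    show "sigma_finite_measure (distr M skeletons (shifted_skeleton 0))" by (rule prob_space_imp_sigma_finite[OF pK])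
    show "sets (\<mu> \<Otimes>\<^sub>M distr M skeletons (shifted_skeleton 0)) =
      sets (distr M (borel \<Otimes>\<^sub>M skeletons) (\<lambda>\<omega>. (Y 0 \<omega>, shifted_skeleton 0 \<omega>)))"
      by (simp add: s\<mu> cong: sets_pair_measure_cong)
    fix A S assume "A \<in> sets \<mu>" "S \<in> sets (distr M skeletons (shifted_skeleton 0))"
    then have A: "A \<in> sets borel" and S: "S \<in> sets skeletons" by (simp_all add: s\<mu>)
    then have "emeasure (distr M (borel \<Otimes>\<^sub>M skeletons) (\<lambda>\<omega>. (Y 0 \<omega>, shifted_skeleton 0 \<omega>))) (A \<times> S)
      = emeasure M {\<omega> \<in> space M. Y 0 \<omega> \<in> A \<and> shifted_skeleton 0 \<omega> \<in> S}"
      by (subst emeasure_distr) (auto intro!: arg_cong[where f = "emeasure M"])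
    then show "emeasure \<mu> A * emeasure (distr M skeletons (shifted_skeleton 0)) S
      = emeasure (distr M (borel \<Otimes>\<^sub>M skeletons) (\<lambda>\<omega>. (Y 0 \<omega>, shifted_skeleton 0 \<omega>))) (A \<times> S)"
      using eq[OF A S] by simp
  qed
qed

end

section \<open>The flow started from Lebesgue measure\<close>

lemma trace_hits_cong:
  assumes "\<And>u. 0 \<le> u \<Longrightarrow> w u = w' u"
  shows "trace_hits U w t E \<longleftrightarrow> trace_hits U w' t E"
proof -
  have "visits U w = visits U w'" using assms by (auto simp: visits_def)
  then show ?thesis using assms[OF real_inverse_clock_nonneg] by (simp add: trace_hits_def)
qed

text \<open>The clock is the Lebesgue measure of a section of a measurable subset of the product
  space, and such section measures are measurable.\<close>

lemma occ_joint_measurable: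
  assumes W: "(\<lambda>(p, u). W p u) \<in> borel_measurable (P \<Otimes>\<^sub>M borel)" and U[measurable]: "U \<in> sets borel"
  shows "(\<lambda>p. occ (visits U (W p)) a) \<in> borel_measurable P"
proof -
  have [measurable]: "(\<lambda>(p, u). W p u) \<in> borel_measurable (P \<Otimes>\<^sub>M lborel)"
    using W by (simp cong: measurable_cong_sets sets_pair_measure_cong)
  define Q where "Q = {x \<in> space (P \<Otimes>\<^sub>M lborel). 0 \<le> snd x \<and> snd x \<le> a \<and> (\<lambda>(p, u). W p u) x \<in> U}"
  have Q: "Q \<in> sets (P \<Otimes>\<^sub>M lborel)" unfolding Q_def by measurable
  have "occ (visits U (W p)) a = enn2real (emeasure lborel (Pair p -` Q))" if "p \<in> space P" for p
  proof -
    have "Pair p -` Q = visits U (W p) \<inter> {0..a}"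
      using that by (auto simp: Q_def visits_def space_pair_measure)
    then show ?thesis by (simp add: occ_def measure_def)
  qed
  moreover have "(\<lambda>p. enn2real (emeasure lborel (Pair p -` Q))) \<in> borel_measurable P"
    using lborel.measurable_emeasure_Pair[OF Q] by measurable
  ultimately show ?thesis by (simp cong: measurable_cong)
qed

lemma inverse_clock_joint_measurable:
  assumes W[measurable]: "(\<lambda>(p, u). W p u) \<in> borel_measurable (P \<Otimes>\<^sub>M borel)" and U[measurable]: "U \<in> sets borel"
  shows "(\<lambda>(p, t). inverse_clock (occ (visits U (W p))) t) \<in> borel_measurable (P \<Otimes>\<^sub>M borel)"
proof -
  have o[measurable]: "(\<lambda>p. occ (visits U (W p)) a) \<in> borel_measurable P" for a
    by (rule occ_joint_measurable[OF W U])
  have sec: "W p \<in> borel_measurable borel" if "p \<in> space P" for p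
    using measurable_compose[OF measurable_Pair1'[OF that] W] by simp
  have "(\<lambda>x. INF q\<in>{q\<in>\<rat>. (0::real) < q}. if snd x < occ (visits U (W (fst x))) q then ereal q else \<infinity>)
    \<in> borel_measurable (P \<Otimes>\<^sub>M borel)"
    by (rule borel_measurable_INF[OF countable_pos_Rats]) measurable
  moreover have "(INF q\<in>{q\<in>\<rat>. (0::real) < q}. if snd x < occ (visits U (W (fst x))) q then ereal q else \<infinity>)
      = (case x of (p, t) \<Rightarrow> inverse_clock (occ (visits U (W p))) t)"
    if "x \<in> space (P \<Otimes>\<^sub>M borel)" for x
  proof -
    have "fst x \<in> space P" using that by (auto simp: space_pair_measure)
    from visits_borel[OF sec[OF this] U] show ?thesis
      unfolding case_prod_beta by (intro inverse_clock_INF[symmetric] occ_mono)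
  qed
  ultimately show ?thesis by (simp cong: measurable_cong)
qed

lemma time_change_joint_measurable:
  assumes W[measurable]: "(\<lambda>(p, u). W p u) \<in> borel_measurable (P \<Otimes>\<^sub>M borel)" and U[measurable]: "U \<in> sets borel"
  shows "(\<lambda>(p, t). W p (real_of_ereal (inverse_clock (occ (visits U (W p))) t))) \<in> borel_measurable (P \<Otimes>\<^sub>M borel)"
proof -
  have [measurable]: "(\<lambda>x. inverse_clock (occ (visits U (W (fst x)))) (snd x)) \<in> borel_measurable (P \<Otimes>\<^sub>M borel)"
    using inverse_clock_joint_measurable[OF assms] unfolding case_prod_beta .
  have "(\<lambda>x. (fst x, real_of_ereal (inverse_clock (occ (visits U (W (fst x)))) (snd x))))
      \<in> measurable (P \<Otimes>\<^sub>M borel) (P \<Otimes>\<^sub>M borel)" by measurable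
  from measurable_compose[OF this W] show ?thesis by (simp add: case_prod_beta)
qed

lemma trace_hits_joint_measurable:
  assumes W: "(\<lambda>(p, u). W p u) \<in> borel_measurable (P \<Otimes>\<^sub>M borel)" and U: "U \<in> sets borel"
    and E[measurable]: "E \<in> sets borel"
  shows "{p \<in> space P. trace_hits U (W p) t E} \<in> sets P"
proof -
  have pair: "(\<lambda>p. (p, t)) \<in> measurable P (P \<Otimes>\<^sub>M borel)" by measurable
  have [measurable]: "(\<lambda>p. inverse_clock (occ (visits U (W p))) t) \<in> borel_measurable P"
    using measurable_compose[OF pair inverse_clock_joint_measurable[OF W U]] by simp
  have [measurable]: "(\<lambda>p. W p (real_of_ereal (inverse_clock (occ (visits U (W p))) t))) \<in> borel_measurable P"
    using measurable_compose[OF pair time_change_joint_measurable[OF W U]] by simp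
  show ?thesis unfolding trace_hits_def by measurable
qed

lemma nn_integral_lborel_shift:
  fixes c :: real
  assumes [measurable]: "f \<in> borel_measurable borel"
  shows "(\<integral>\<^sup>+ x. f (c + x) \<partial>lborel) = (\<integral>\<^sup>+ x. f x \<partial>lborel)"
proof -
  have "(\<integral>\<^sup>+ x. f x \<partial>distr lborel borel (\<lambda>x. c + x)) = (\<integral>\<^sup>+ x. f (c + x) \<partial>lborel)"
    by (rule nn_integral_distr) auto
  then show ?thesis by (simp add: lborel_distr_plus)
qed

section \<open>Invariance of the flow under time shifts\<close>

context levy_from
begin

text \<open>Clamping time at \<open>0\<close> makes the increments jointly measurable on the whole line, as nothing is
  assumed about \<open>Y\<close> at negative times.\<close>

definition Z :: "real \<Rightarrow> 'a \<Rightarrow> real" where "Z s \<omega> = Y (max 0 s) \<omega> - Y (max 0 0) \<omega>"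

lemma Z_measurable [measurable (raw)]:
  assumes [measurable]: "f \<in> borel_measurable N" "g \<in> measurable N M"
  shows "(\<lambda>x. Z (f x) (g x)) \<in> borel_measurable N"
  unfolding Z_def by measurable

text \<open>The pair \<open>(x, \<omega>)\<close> stands for the path
  \<open>x + Z u \<omega>\<close>; the image of this measure on such paths is the infinite measure
  invariant under time shifts.\<close>

abbreviation flow :: "(real \<times> 'a) measure" where "flow \<equiv> lborel \<Otimes>\<^sub>M M"

lemma pair_flow: "pair_sigma_finite lborel M"
  by standard

lemma nn_integral_flow:
  "f \<in> borel_measurable flow \<Longrightarrow> (\<integral>\<^sup>+ p. f p \<partial>flow) = (\<integral>\<^sup>+ \<omega>. \<integral>\<^sup>+ x. f (x, \<omega>) \<partial>lborel \<partial>M)"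
  by (rule pair_sigma_finite.nn_integral_snd[OF pair_flow, symmetric])

definition flow_mass :: "(real \<times> (real \<Rightarrow> real)) set \<Rightarrow> ennreal" where
  "flow_mass G = (\<integral>\<^sup>+ z. \<integral>\<^sup>+ x. indicator G (x, z) \<partial>lborel \<partial>distr M skeletons (shifted_skeleton 0))"

text \<open>For fixed \<open>\<omega>\<close> the translation by \<open>Z s \<omega>\<close>
  preserves Lebesgue measure in \<open>x\<close>; what remains depends only on the law of the
  shifted skeleton, which does not change with \<open>s\<close>.\<close>

lemma flow_mass_invariant:
  assumes G[measurable]: "G \<in> sets (borel \<Otimes>\<^sub>M skeletons)" and s: "0 \<le> s"
  shows "(\<integral>\<^sup>+ p. indicator G (fst p + Z s (snd p), shifted_skeleton s (snd p)) \<partial>flow) = flow_mass G"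
proof -
  have [measurable]: "(\<lambda>z. \<integral>\<^sup>+ x. indicator G (x, z) \<partial>lborel) \<in> borel_measurable skeletons"
    by (rule lborel.borel_measurable_nn_integral) measurable
  have m: "(\<lambda>p. indicator G (fst p + Z s (snd p), shifted_skeleton s (snd p)) :: ennreal) \<in> borel_measurable flow"
    by measurable
  have "(\<integral>\<^sup>+ p. indicator G (fst p + Z s (snd p), shifted_skeleton s (snd p)) \<partial>flow)
    = (\<integral>\<^sup>+ \<omega>. \<integral>\<^sup>+ x. indicator G (x + Z s \<omega>, shifted_skeleton s \<omega>) \<partial>lborel \<partial>M)"
    using nn_integral_flow[OF m] by simp
  also have "\<dots> = (\<integral>\<^sup>+ \<omega>. \<integral>\<^sup>+ x. indicator G (x, shifted_skeleton s \<omega>) \<partial>lborel \<partial>M)"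
  proof (rule nn_integral_cong)
    fix \<omega> assume [measurable]: "\<omega> \<in> space M"
    have [measurable]: "shifted_skeleton s \<omega> \<in> space skeletons"
      using measurable_space[of "shifted_skeleton s" M skeletons] \<open>\<omega> \<in> space M\<close> by simp
    have "(\<lambda>x. indicator G (x, shifted_skeleton s \<omega>) :: ennreal) \<in> borel_measurable borel"
      by measurable
    from nn_integral_lborel_shift[OF this, of "Z s \<omega>"]
    show "(\<integral>\<^sup>+ x. indicator G (x + Z s \<omega>, shifted_skeleton s \<omega>) \<partial>lborel)
      = (\<integral>\<^sup>+ x. indicator G (x, shifted_skeleton s \<omega>) \<partial>lborel)"
      by (simp add: add.commute)
  qed
  also have "\<dots> = (\<integral>\<^sup>+ z. \<integral>\<^sup>+ x. indicator G (x, z) \<partial>lborel \<partial>distr M skeletons (shifted_skeleton s))"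
    by (subst nn_integral_distr) auto
  also have "\<dots> = flow_mass G"
    by (simp add: flow_mass_def distr_shifted_skeleton[OF s])
  finally show ?thesis .
qed

lemma nn_integral_flow_shift:
  assumes [measurable]: "f \<in> borel_measurable borel"
  shows "(\<integral>\<^sup>+ p. f (fst p + Z s (snd p)) \<partial>flow) = (\<integral>\<^sup>+ x. f x \<partial>lborel)"
proof -
  have m: "(\<lambda>p. f (fst p + Z s (snd p))) \<in> borel_measurable flow"
    by measurable
  have "(\<integral>\<^sup>+ p. f (fst p + Z s (snd p)) \<partial>flow) = (\<integral>\<^sup>+ \<omega>. \<integral>\<^sup>+ x. f (x + Z s \<omega>) \<partial>lborel \<partial>M)"
    using nn_integral_flow[OF m] by simp
  also have "\<dots> = (\<integral>\<^sup>+ \<omega>. \<integral>\<^sup>+ x. f x \<partial>lborel \<partial>M)"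
    by (rule nn_integral_cong) (simp add: nn_integral_lborel_shift[OF assms] add.commute[of _ "Z s _"])
  finally show ?thesis by (simp add: emeasure_space_1)
qed

text \<open>The hitting event is expressed through the present position and the skeleton of the
  future increments, because invariance of the flow is available for sets of such pairs.\<close>

definition trace_event :: "real set \<Rightarrow> real \<Rightarrow> real set \<Rightarrow> (real \<times> (real \<Rightarrow> real)) set" where
  "trace_event U t E = {p \<in> space (borel \<Otimes>\<^sub>M skeletons). fst p \<in> U \<and>
     trace_hits U (\<lambda>u. fst p + skeleton_path (snd p) u) t E}"

lemma trace_event_measurable [measurable]:
  assumes [measurable]: "U \<in> sets borel" "E \<in> sets borel"
  shows "trace_event U t E \<in> sets (borel \<Otimes>\<^sub>M skeletons)"
proof -
  have "(\<lambda>x. (snd x, snd (fst x))) \<in> measurable ((borel \<Otimes>\<^sub>M skeletons) \<Otimes>\<^sub>M borel) (borel \<Otimes>\<^sub>M skeletons)"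
    by measurable
  from measurable_compose[OF this skeleton_path_measurable]
  have [measurable]: "(\<lambda>x. skeleton_path (snd (fst x)) (snd x)) \<in> borel_measurable ((borel \<Otimes>\<^sub>M skeletons) \<Otimes>\<^sub>M borel)"
    by simp
  have "(\<lambda>(p, u). fst p + skeleton_path (snd p) u) \<in> borel_measurable ((borel \<Otimes>\<^sub>M skeletons) \<Otimes>\<^sub>M borel)"
    unfolding case_prod_beta by measurable
  from trace_hits_joint_measurable[OF this assms, of t]
  have "{p \<in> space (borel \<Otimes>\<^sub>M skeletons). trace_hits U (\<lambda>u. fst p + skeleton_path (snd p) u) t E} \<in> sets (borel \<Otimes>\<^sub>M skeletons)" .
  moreover have "{p \<in> space (borel \<Otimes>\<^sub>M skeletons :: (real \<times> (real \<Rightarrow> real)) measure). fst p \<in> U} \<in> sets (borel \<Otimes>\<^sub>M skeletons)"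
    by measurable
  ultimately have "{p \<in> space (borel \<Otimes>\<^sub>M skeletons). fst p \<in> U} \<inter>
    {p \<in> space (borel \<Otimes>\<^sub>M skeletons). trace_hits U (\<lambda>u. fst p + skeleton_path (snd p) u) t E} \<in> sets (borel \<Otimes>\<^sub>M skeletons)"
    by (rule sets.Int[rotated])
  also have "{p \<in> space (borel \<Otimes>\<^sub>M skeletons). fst p \<in> U} \<inter>
    {p \<in> space (borel \<Otimes>\<^sub>M skeletons). trace_hits U (\<lambda>u. fst p + skeleton_path (snd p) u) t E} = trace_event U t E"
    by (auto simp: trace_event_def)
  finally show ?thesis .
qed

lemma shifted_skeleton_space: "\<omega> \<in> space M \<Longrightarrow> shifted_skeleton s \<omega> \<in> space skeletons"
  by (rule measurable_space[of "shifted_skeleton s" M]) measurable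

lemma trace_event_iff:
  assumes \<omega>: "\<omega> \<in> space M" and s: "0 \<le> s"
  shows "(x + Z s \<omega>, shifted_skeleton s \<omega>) \<in> trace_event U t E
    \<longleftrightarrow> x + Z s \<omega> \<in> U \<and> trace_hits U (\<lambda>u. x + Z (s + u) \<omega>) t E"
proof -
  have "trace_hits U (\<lambda>u. x + Z s \<omega> + skeleton_path (shifted_skeleton s \<omega>) u) t E
    \<longleftrightarrow> trace_hits U (\<lambda>u. x + Z (s + u) \<omega>) t E"
    by (rule trace_hits_cong) (use s in \<open>simp add: skeleton_path_shifted[OF \<omega> s] Z_def\<close>)
  then show ?thesis
    using shifted_skeleton_space[OF \<omega>] by (simp add: trace_event_def space_pair_measure)
qed

lemma flow_path:
  assumes "\<omega> \<in> space M"
  shows "(\<lambda>u. x + Z u \<omega>) \<in> borel_measurable borel" and "right_cont_path (\<lambda>u. x + Z u \<omega>)"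
proof -
  note [measurable] = assms
  show "(\<lambda>u. x + Z u \<omega>) \<in> borel_measurable borel" by measurable
  show "right_cont_path (\<lambda>u. x + Z u \<omega>)" unfolding right_cont_path_def
  proof safe
    fix t :: real assume t: "0 \<le> t"
    have "continuous (at_right t) (\<lambda>u. Y u \<omega>)" using right_cont_Y[OF assms] t by (simp add: right_cont_path_def)
    then have "((\<lambda>u. x + (Y u \<omega> - Y 0 \<omega>)) \<longlongrightarrow> x + (Y t \<omega> - Y 0 \<omega>)) (at_right t)"
      unfolding continuous_within by (intro tendsto_intros)
    moreover have "eventually (\<lambda>u. x + (Y u \<omega> - Y 0 \<omega>) = x + Z u \<omega>) (at_right t)"
      using t by (auto simp: eventually_at_filter Z_def)
    ultimately have "((\<lambda>u. x + Z u \<omega>) \<longlongrightarrow> x + (Y t \<omega> - Y 0 \<omega>)) (at_right t)"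
      by (rule Lim_transform_eventually)
    then show "continuous (at_right t) (\<lambda>u. x + Z u \<omega>)" using t by (simp add: continuous_within Z_def)
  qed
qed

lemma flow_occ_measurable [measurable]:
  assumes "U \<in> sets borel"
  shows "(\<lambda>p. occ (visits U (\<lambda>u. fst p + Z u (snd p))) a) \<in> borel_measurable flow"
  by (rule occ_joint_measurable[OF _ assms]) measurable

section \<open>Occupation time estimates under the flow\<close>

lemma Fubini_flow:
  assumes "(\<lambda>(s, p). f s p) \<in> borel_measurable (lborel \<Otimes>\<^sub>M flow)"
  shows "(\<integral>\<^sup>+ s. \<integral>\<^sup>+ p. f s p \<partial>flow \<partial>lborel) = (\<integral>\<^sup>+ p. \<integral>\<^sup>+ s. f s p \<partial>lborel \<partial>flow)"
proof -
  interpret F: pair_sigma_finite lborel M by (rule pair_flow)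
  interpret P: pair_sigma_finite lborel flow by standard
  show ?thesis using P.Fubini'[OF assms] by simp
qed

text \<open>Invariance spreads the left side over \<open>s\<close> in \<open>{0..T}\<close>, and
  Fubini makes the pathwise bound \<open>trace_hits_integral_le\<close> applicable for each
  \<open>p\<close>. A second use of Fubini evaluates the mean time in \<open>U \<inter> E\<close>,
  since at every fixed time the position is Lebesgue distributed.\<close>

lemma trace_event_flow_le:
  assumes U: "open U" and E[measurable]: "E \<in> sets borel" and t: "0 \<le> t" and T: "0 \<le> T"
  shows "ennreal T * flow_mass (trace_event U t E) \<le> ennreal T * emeasure lborel (U \<inter> E)
    + (\<integral>\<^sup>+ p. ennreal (min t (occ (visits U (\<lambda>u. fst p + Z u (snd p))) T)) \<partial>flow)"
proof -
  have Ub[measurable]: "U \<in> sets borel" using U by simp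
  define G where "G = trace_event U t E"
  have [measurable]: "G \<in> sets (borel \<Otimes>\<^sub>M skeletons)" unfolding G_def by measurable
  have "ennreal T * flow_mass G = (\<integral>\<^sup>+ s. indicator {0..T} s * flow_mass G \<partial>lborel)"
    using T by (simp add: nn_integral_multc emeasure_lborel_Icc_eq)
  also have "\<dots> = (\<integral>\<^sup>+ s. \<integral>\<^sup>+ p. indicator {0..T} s * indicator G (fst p + Z s (snd p), shifted_skeleton s (snd p)) \<partial>flow \<partial>lborel)"
    by (rule nn_integral_cong) (auto simp: indicator_def flow_mass_invariant[unfolded indicator_def])
  also have "\<dots> = (\<integral>\<^sup>+ p. \<integral>\<^sup>+ s. indicator {0..T} s * indicator G (fst p + Z s (snd p), shifted_skeleton s (snd p)) \<partial>lborel \<partial>flow)"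
    by (rule Fubini_flow) measurable
  also have "\<dots> \<le> (\<integral>\<^sup>+ p. (\<integral>\<^sup>+ s. indicator {0..T} s * indicator (U \<inter> E) (fst p + Z s (snd p)) \<partial>lborel)
      + ennreal (min t (occ (visits U (\<lambda>u. fst p + Z u (snd p))) T)) \<partial>flow)"
  proof (rule nn_integral_mono)
    fix p assume "p \<in> space flow"
    then have \<omega>: "snd p \<in> space M" by (auto simp: space_pair_measure)
    define w where "w = (\<lambda>u. fst p + Z u (snd p))"
    have w: "w \<in> borel_measurable borel" "right_cont_path w" unfolding w_def by (rule flow_path[OF \<omega>])+
    have "(\<integral>\<^sup>+ s. indicator {0..T} s * indicator G (fst p + Z s (snd p), shifted_skeleton s (snd p)) \<partial>lborel)
      = (\<integral>\<^sup>+ s. indicator {s. trace_hits U (\<lambda>u. w (s + u)) t E} s * indicator (visits U w \<inter> {0..T}) s \<partial>lborel)"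
      by (rule nn_integral_cong)
        (auto simp: indicator_def G_def trace_event_iff[OF \<omega>] visits_def w_def)
    also have "\<dots> \<le> (\<integral>\<^sup>+ s. indicator (visits (U \<inter> E) w \<inter> {0..T}) s \<partial>lborel) + ennreal (min t (occ (visits U w) T))"
      by (rule trace_hits_integral_le[OF w U E t T])
    also have "(\<integral>\<^sup>+ s. indicator (visits (U \<inter> E) w \<inter> {0..T}) s \<partial>lborel)
      = (\<integral>\<^sup>+ s. indicator {0..T} s * indicator (U \<inter> E) (fst p + Z s (snd p)) \<partial>lborel)"
      by (rule nn_integral_cong) (auto simp: indicator_def visits_def w_def)
    finally show "(\<integral>\<^sup>+ s. indicator {0..T} s * indicator G (fst p + Z s (snd p), shifted_skeleton s (snd p)) \<partial>lborel)
      \<le> (\<integral>\<^sup>+ s. indicator {0..T} s * indicator (U \<inter> E) (fst p + Z s (snd p)) \<partial>lborel)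
      + ennreal (min t (occ (visits U (\<lambda>u. fst p + Z u (snd p))) T))" by (simp add: w_def)
  qed
  also have "\<dots> = (\<integral>\<^sup>+ p. (\<integral>\<^sup>+ s. indicator {0..T} s * indicator (U \<inter> E) (fst p + Z s (snd p)) \<partial>lborel) \<partial>flow)
      + (\<integral>\<^sup>+ p. ennreal (min t (occ (visits U (\<lambda>u. fst p + Z u (snd p))) T)) \<partial>flow)"
    by (rule nn_integral_add) measurable
  also have "(\<integral>\<^sup>+ p. (\<integral>\<^sup>+ s. indicator {0..T} s * indicator (U \<inter> E) (fst p + Z s (snd p)) \<partial>lborel) \<partial>flow)
    = (\<integral>\<^sup>+ s. (\<integral>\<^sup>+ p. indicator {0..T} s * indicator (U \<inter> E) (fst p + Z s (snd p)) \<partial>flow) \<partial>lborel)"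
    by (rule Fubini_flow[symmetric]) measurable
  also have "\<dots> = (\<integral>\<^sup>+ s. indicator {0..T} s * emeasure lborel (U \<inter> E) \<partial>lborel)"
  proof (rule nn_integral_cong)
    fix s :: real
    have "(\<integral>\<^sup>+ p. indicator {0..T} s * indicator (U \<inter> E) (fst p + Z s (snd p)) \<partial>flow)
      = indicator {0..T} s * (\<integral>\<^sup>+ p. indicator (U \<inter> E) (fst p + Z s (snd p)) \<partial>flow)"
      by (rule nn_integral_cmult) measurable
    also have "(\<integral>\<^sup>+ p. indicator (U \<inter> E) (fst p + Z s (snd p)) \<partial>flow) = emeasure lborel (U \<inter> E)"
      by (subst nn_integral_flow_shift) auto
    finally show "(\<integral>\<^sup>+ p. indicator {0..T} s * indicator (U \<inter> E) (fst p + Z s (snd p)) \<partial>flow)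
      = indicator {0..T} s * emeasure lborel (U \<inter> E)" .
  qed
  also have "\<dots> = ennreal T * emeasure lborel (U \<inter> E)"
    using T by (simp add: nn_integral_multc emeasure_lborel_Icc_eq)
  finally show ?thesis by (simp add: G_def)
qed

text \<open>Starting points within distance \<open>R\<close> of 0 contribute at most
  \<open>c\<close> each, over an interval of length \<open>2 * R\<close>. For the others the minimum
  with \<open>c\<close> is dropped and the occupation time is integrated over
  \<open>s\<close>.\<close>

lemma occupation_le:
  assumes R: "0 \<le> R" and c: "0 \<le> c" and T: "0 \<le> T"
    and \<delta>: "\<And>s. 0 \<le> s \<Longrightarrow> s \<le> T \<Longrightarrow> emeasure M {\<omega> \<in> space M. R - 1 < \<bar>Z s \<omega>\<bar>} \<le> \<delta>"
  shows "(\<integral>\<^sup>+ p. ennreal (min c (occ (visits {-1<..<1} (\<lambda>u. fst p + Z u (snd p))) T)) \<partial>flow)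
    \<le> ennreal (2 * R * c) + ennreal T * (2 * \<delta>)"
proof -
  define V where "V s p = indicator {0..T} s * (indicator {p. R < \<bar>fst p\<bar>} p * indicator {-1<..<1} (fst p + Z s (snd p)) :: ennreal)" for s and p :: "real \<times> 'a"
  have V: "(\<lambda>(s, p). V s p) \<in> borel_measurable (lborel \<Otimes>\<^sub>M flow)"
    unfolding V_def indicator_def case_prod_beta by measurable
  have m: "(\<lambda>p. indicator {p. \<bar>fst p\<bar> \<le> R} p :: ennreal) \<in> borel_measurable flow"
    unfolding indicator_def by measurable
  have "(\<integral>\<^sup>+ p. ennreal (min c (occ (visits {-1<..<1} (\<lambda>u. fst p + Z u (snd p))) T)) \<partial>flow)
    \<le> (\<integral>\<^sup>+ p. ennreal c * indicator {p. \<bar>fst p\<bar> \<le> R} p + (\<integral>\<^sup>+ s. V s p \<partial>lborel) \<partial>flow)"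
  proof (rule nn_integral_mono)
    fix p assume "p \<in> space flow"
    then have \<omega>: "snd p \<in> space M" by (auto simp: space_pair_measure)
    define w where "w = (\<lambda>u. fst p + Z u (snd p))"
    have b: "visits {-1<..<1} w \<in> sets borel"
      unfolding w_def by (rule visits_borel[OF flow_path(1)[OF \<omega>]]) simp
    show "ennreal (min c (occ (visits {-1<..<1} (\<lambda>u. fst p + Z u (snd p))) T))
      \<le> ennreal c * indicator {p. \<bar>fst p\<bar> \<le> R} p + (\<integral>\<^sup>+ s. V s p \<partial>lborel)"
    proof (cases "\<bar>fst p\<bar> \<le> R")
      case True
      have "ennreal (min c (occ (visits {-1<..<1} w) T)) \<le> ennreal c" by (rule ennreal_leI) simp
      then show ?thesis using True by (simp add: w_def add_increasing2)
    next
      case False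
      have "ennreal (min c (occ (visits {-1<..<1} w) T)) \<le> ennreal (occ (visits {-1<..<1} w) T)"
        by (rule ennreal_leI) simp
      also have "\<dots> = (\<integral>\<^sup>+ s. indicator (visits {-1<..<1} w) s * indicator {0..T} s \<partial>lborel)"
        by (rule ennreal_occ[OF b])
      also have "\<dots> = (\<integral>\<^sup>+ s. V s p \<partial>lborel)"
        by (rule nn_integral_cong) (use False in \<open>auto simp: V_def indicator_def visits_def w_def\<close>)
      finally show ?thesis using False by (simp add: w_def)
    qed
  qed
  also have "\<dots> = ennreal c * (\<integral>\<^sup>+ p. indicator {p. \<bar>fst p\<bar> \<le> R} p \<partial>flow) + (\<integral>\<^sup>+ p. \<integral>\<^sup>+ s. V s p \<partial>lborel \<partial>flow)"
  proof -
    have "(\<lambda>p. \<integral>\<^sup>+ s. V s p \<partial>lborel) \<in> borel_measurable flow"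
      unfolding V_def indicator_def by measurable
    then show ?thesis using m by (simp add: nn_integral_add nn_integral_cmult)
  qed
  also have "(\<integral>\<^sup>+ p. indicator {p. \<bar>fst p\<bar> \<le> R} p \<partial>flow) = ennreal (2 * R)"
  proof -
    have "indicator {p. \<bar>fst p\<bar> \<le> R} (x, \<omega>) = (indicator {-R..R} x :: ennreal)" for x and \<omega> :: 'a
      by (auto simp: indicator_def)
    then have "(\<integral>\<^sup>+ p. indicator {p. \<bar>fst p\<bar> \<le> R} p \<partial>flow) = (\<integral>\<^sup>+ \<omega>. \<integral>\<^sup>+ x. indicator {-R..R} x \<partial>lborel \<partial>M)"
      using nn_integral_flow[OF m] by simp
    then show ?thesis using R by (simp add: emeasure_lborel_Icc_eq emeasure_space_1)
  qed
  also have "(\<integral>\<^sup>+ p. \<integral>\<^sup>+ s. V s p \<partial>lborel \<partial>flow) = (\<integral>\<^sup>+ s. \<integral>\<^sup>+ p. V s p \<partial>flow \<partial>lborel)"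
    by (rule Fubini_flow[OF V, symmetric])
  also have "\<dots> \<le> (\<integral>\<^sup>+ s. indicator {0..T} s * (2 * \<delta>) \<partial>lborel)"
  proof (rule nn_integral_mono)
    fix s :: real
    show "(\<integral>\<^sup>+ p. V s p \<partial>flow) \<le> indicator {0..T} s * (2 * \<delta>)"
    proof (cases "0 \<le> s \<and> s \<le> T")
      case True
      define B where "B = {\<omega> \<in> space M. R - 1 < \<bar>Z s \<omega>\<bar>}"
      have [measurable]: "B \<in> sets M" unfolding B_def by measurable
      have m: "(\<lambda>p. indicator B (snd p) * indicator {-1<..<1} (fst p + Z s (snd p)) :: ennreal) \<in> borel_measurable flow"
        by measurable
      \<comment> \<open>A path that starts outside \<open>{-R..R}\<close> and is in the interval at
        time \<open>s\<close> has moved by more than \<open>R - 1\<close>. For given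
        \<open>\<omega>\<close>, the starting points that put it there at time \<open>s\<close> form
        an interval of length 2.\<close>
      have "(\<integral>\<^sup>+ p. V s p \<partial>flow) \<le> (\<integral>\<^sup>+ p. indicator B (snd p) * indicator {-1<..<1} (fst p + Z s (snd p)) \<partial>flow)"
        by (rule nn_integral_mono) (auto simp: V_def B_def indicator_def space_pair_measure)
      also have "\<dots> = (\<integral>\<^sup>+ \<omega>. \<integral>\<^sup>+ x. indicator B \<omega> * indicator {-1<..<1} (x + Z s \<omega>) \<partial>lborel \<partial>M)"
        using nn_integral_flow[OF m] by simp
      also have "\<dots> = (\<integral>\<^sup>+ \<omega>. indicator B \<omega> * 2 \<partial>M)"
      proof (rule nn_integral_cong)
        fix \<omega>
        have "(\<integral>\<^sup>+ x. indicator {-1<..<1} (Z s \<omega> + x) \<partial>lborel) = (\<integral>\<^sup>+ x. indicator {-1<..<1::real} x \<partial>lborel)"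
          by (rule nn_integral_lborel_shift) measurable
        also have "\<dots> = 2" by (simp add: emeasure_lborel_Ioo)
        finally have "(\<integral>\<^sup>+ x. indicator {-1<..<1} (x + Z s \<omega>) \<partial>lborel) = 2"
          by (simp only: add.commute[of _ "Z s \<omega>"])
        moreover have "(\<integral>\<^sup>+ x. indicator B \<omega> * indicator {-1<..<1} (x + Z s \<omega>) \<partial>lborel)
          = indicator B \<omega> * (\<integral>\<^sup>+ x. indicator {-1<..<1} (x + Z s \<omega>) \<partial>lborel)"
          by (rule nn_integral_cmult) measurable
        ultimately show "(\<integral>\<^sup>+ x. indicator B \<omega> * indicator {-1<..<1} (x + Z s \<omega>) \<partial>lborel) = indicator B \<omega> * 2"
          by simp
      qed
      also have "\<dots> = emeasure M B * 2"
        by (simp add: nn_integral_multc)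
      also have "\<dots> \<le> \<delta> * 2" unfolding B_def by (rule mult_right_mono) (use \<delta>[of s] True in auto)
      finally show ?thesis using True by (simp add: mult.commute)
    next
      case False
      then have "V s p = 0" for p by (auto simp: V_def indicator_def)
      then show ?thesis by simp
    qed
  qed
  also have "\<dots> = ennreal T * (2 * \<delta>)"
    using T by (simp add: nn_integral_multc emeasure_lborel_Icc_eq)
  finally show ?thesis using R c by (simp add: ennreal_mult[symmetric] mult_ac)
qed

end

section \<open>Laplace transforms and the weak law of large numbers\<close>

definition real_exponent :: "real measure \<Rightarrow> real \<Rightarrow> real" where
  "real_exponent \<phi> \<xi> = (LINT y|\<phi>. exp (- \<xi> * y) - 1 + \<xi> * y)"

lemma laplace_exponent_of_real:
  "laplace_exponent \<phi> (complex_of_real \<xi>) = complex_of_real (real_exponent \<phi> \<xi>)"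
proof -
  have "exp (- complex_of_real \<xi> * complex_of_real y) - 1 + complex_of_real \<xi> * complex_of_real y
    = complex_of_real (exp (- \<xi> * y) - 1 + \<xi> * y)" for y
    by (simp flip: exp_of_real)
  then show ?thesis unfolding laplace_exponent_def real_exponent_def
    by (simp only: integral_complex_of_real)
qed

text \<open>The linear and the quadratic upper bound together match the integrability of
  \<open>min (y\<^sup>2) y\<close>. For the quadratic one, \<open>h\<close> vanishes at 0 and has
  derivative \<open>x - 1 + exp (- x) \<ge> 0\<close>.\<close>

lemma exponent_integrand_bounds:
  fixes \<xi> y :: real
  assumes "0 \<le> \<xi>" "0 \<le> y"
  shows "0 \<le> exp (- \<xi> * y) - 1 + \<xi> * y" "exp (- \<xi> * y) - 1 + \<xi> * y \<le> \<xi> * y"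
    "exp (- \<xi> * y) - 1 + \<xi> * y \<le> (\<xi> * y)\<^sup>2 / 2"
proof -
  show "0 \<le> exp (- \<xi> * y) - 1 + \<xi> * y" using exp_ge_add_one_self[of "- \<xi> * y"] by simp
  have "0 \<le> \<xi> * y" using assms by simp
  then show "exp (- \<xi> * y) - 1 + \<xi> * y \<le> \<xi> * y" by simp
  define h where "h x = x\<^sup>2 / 2 - x + 1 - exp (- x)" for x :: real
  have "h 0 \<le> h (\<xi> * y)"
  proof (rule DERIV_nonneg_imp_nondecreasing[OF \<open>0 \<le> \<xi> * y\<close>])
    fix x :: real assume "0 \<le> x" "x \<le> \<xi> * y"
    have "DERIV h x :> x - 1 + exp (- x)" unfolding h_def
      by (auto intro!: derivative_eq_intros)
    moreover have "0 \<le> x - 1 + exp (- x)" using exp_ge_add_one_self[of "- x"] by simp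
    ultimately show "\<exists>d. DERIV h x :> d \<and> 0 \<le> d" by blast
  qed
  then show "exp (- \<xi> * y) - 1 + \<xi> * y \<le> (\<xi> * y)\<^sup>2 / 2" by (simp add: h_def)
qed

context
  fixes \<phi> :: "real measure"
  assumes adm: "admissible_jump_measure \<phi>"
begin

lemma jump_measurable: "f \<in> borel_measurable borel \<Longrightarrow> f \<in> borel_measurable \<phi>"
proof -
  assume "f \<in> borel_measurable borel"
  then have "f \<in> borel_measurable (restrict_space borel {0<..})" by (rule measurable_restrict_space1)
  then show ?thesis using adm by (simp add: admissible_jump_measure_def cong: measurable_cong_sets)
qed

lemma jump_space: "space \<phi> = {0<..}"
  using adm sets_eq_imp_space_eq[of \<phi> "restrict_space borel {0<..}"]
  by (simp add: admissible_jump_measure_def space_restrict_space)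

lemma integrable_min: "integrable \<phi> (\<lambda>y. min (y\<^sup>2) y)"
proof (rule integrableI_nonneg)
  show "(\<lambda>y. min (y\<^sup>2) y) \<in> borel_measurable \<phi>" by (rule jump_measurable) measurable
  show "AE y in \<phi>. 0 \<le> min (y\<^sup>2) y" by (rule AE_I2) (simp add: jump_space)
  show "(\<integral>\<^sup>+ y. ennreal (min (y\<^sup>2) y) \<partial>\<phi>) < \<infinity>" using adm by (simp add: admissible_jump_measure_def)
qed

lemma real_exponent_nonneg: "0 \<le> \<xi> \<Longrightarrow> 0 \<le> real_exponent \<phi> \<xi>"
  unfolding real_exponent_def
  by (rule integral_nonneg_AE, rule AE_I2) (use exponent_integrand_bounds(1)[of \<xi>] in \<open>auto simp: jump_space\<close>)

text \<open>The exponent has slope 0 at the origin, reflecting that the process is centred. The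
  quadratic bound gives pointwise convergence of the integrands, and both bounds together dominate
  them by \<open>2 * min (y\<^sup>2) y\<close>.\<close>

lemma real_exponent_tendsto: "(\<lambda>n. real (Suc n) * real_exponent \<phi> (2 / real (Suc n))) \<longlonglongrightarrow> 0"
proof -
  define g where "g n y = real (Suc n) * (exp (- (2 / real (Suc n)) * y) - 1 + (2 / real (Suc n)) * y)" for n y
  have bnd: "0 \<le> g n y" "g n y \<le> 2 * y" "g n y \<le> 2 * y\<^sup>2 / real (Suc n)" if "0 \<le> y" for n y
  proof -
    define a where "a = real (Suc n)"
    have a: "0 < a" by (simp add: a_def)
    note b = exponent_integrand_bounds[of "2 / a" y]
    show "0 \<le> g n y" unfolding g_def a_def[symmetric] using b(1) a that by simp
    have "a * (exp (- (2 / a) * y) - 1 + 2 / a * y) \<le> a * (2 / a * y)"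
      by (rule mult_left_mono) (use b(2) a that in auto)
    then show "g n y \<le> 2 * y" unfolding g_def a_def[symmetric] using a by simp
    have "a * (exp (- (2 / a) * y) - 1 + 2 / a * y) \<le> a * ((2 / a * y)\<^sup>2 / 2)"
      by (rule mult_left_mono) (use b(3) a that in auto)
    also have "\<dots> = 2 * y\<^sup>2 / a" using a by (simp add: power2_eq_square field_simps)
    finally show "g n y \<le> 2 * y\<^sup>2 / real (Suc n)" unfolding g_def a_def[symmetric] .
  qed
  have lim: "(\<lambda>n. g n y) \<longlonglongrightarrow> 0" if "0 \<le> y" for y
  proof (rule real_tendsto_sandwich[OF _ _ tendsto_const])
    show "(\<lambda>n. 2 * y\<^sup>2 / real (Suc n)) \<longlonglongrightarrow> 0"
      by (rule LIMSEQ_Suc[OF lim_const_over_n])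
  qed (use bnd[OF that] in auto)
  have "(\<lambda>n. LINT y|\<phi>. g n y) \<longlonglongrightarrow> (LINT y|\<phi>. 0)"
  proof (rule integral_dominated_convergence)
    show "integrable \<phi> (\<lambda>y. 2 * min (y\<^sup>2) y)" using integrable_min by simp
    show "AE y in \<phi>. (\<lambda>n. g n y) \<longlonglongrightarrow> 0" by (rule AE_I2) (simp add: jump_space lim)
    show "AE y in \<phi>. norm (g n y) \<le> 2 * min (y\<^sup>2) y" for n
    proof (rule AE_I2)
      fix y assume "y \<in> space \<phi>"
      then have y: "0 \<le> y" by (simp add: jump_space)
      have "2 * y\<^sup>2 / real (Suc n) \<le> 2 * y\<^sup>2 / 1" by (rule divide_left_mono) auto
      then show "norm (g n y) \<le> 2 * min (y\<^sup>2) y" using bnd[OF y, of n] by (simp add: min_def)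
    qed
    show "g n \<in> borel_measurable \<phi>" for n unfolding g_def by (rule jump_measurable) measurable
  qed (simp add: jump_measurable)
  moreover have "(LINT y|\<phi>. g n y) = real (Suc n) * real_exponent \<phi> (2 / real (Suc n))" for n
    unfolding g_def real_exponent_def by (rule integral_mult_right_zero)
  ultimately show ?thesis by simp
qed

end

text \<open>Posed in \<open>ennreal\<close> because the Laplace transform at fractions of the unit
  time is not yet known to be finite; an infinite \<open>x\<close> is ruled out by its finite
  power.\<close>

lemma ennreal_root:
  assumes "(x::ennreal) ^ m = ennreal (exp a)" "0 < m"
  shows "x = ennreal (exp (a / real m))"
proof (cases x)
  case (real r)
  then have "ennreal (r ^ m) = ennreal (exp a)" using assms by (simp add: ennreal_power)
  then have "r ^ m = exp a" using real by simp
  also have "\<dots> = exp (a / real m) ^ m" using assms(2) by (simp flip: exp_of_nat_mult)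
  finally have "r = exp (a / real m)"
    by (rule power_eq_imp_eq_base) (use real assms(2) in auto)
  then show ?thesis using real by simp
next
  case top
  then have "x ^ m = top" using assms(2) by (simp add: power_eq_top_ennreal)
  then show ?thesis using assms(1) by simp
qed

section \<open>Laplace transforms and tails of the increments\<close>

context levy_from
begin

text \<open>As a nonnegative integral it is defined, and multiplicative in time, before any
  integrability is known.\<close>

definition laplace :: "real \<Rightarrow> real \<Rightarrow> ennreal" where
  "laplace \<xi> t = (\<integral>\<^sup>+ \<omega>. ennreal (exp (- \<xi> * (Y t \<omega> - Y 0 \<omega>))) \<partial>M)"

lemma laplace_0: "laplace \<xi> 0 = 1"
  by (simp add: laplace_def emeasure_space_1)

lemma laplace_increment:
  assumes "0 \<le> s" "0 \<le> t"
  shows "(\<integral>\<^sup>+ \<omega>. ennreal (exp (- \<xi> * (Y (s + t) \<omega> - Y s \<omega>))) \<partial>M) = laplace \<xi> t"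
proof -
  have "(\<integral>\<^sup>+ \<omega>. ennreal (exp (- \<xi> * (Y (s + t) \<omega> - Y s \<omega>))) \<partial>M)
    = (\<integral>\<^sup>+ x. ennreal (exp (- \<xi> * x)) \<partial>distr M borel (\<lambda>\<omega>. Y (s + t) \<omega> - Y s \<omega>))"
    using assms by (subst nn_integral_distr) auto
  also have "\<dots> = laplace \<xi> t"
    unfolding increments_stationary[OF assms] laplace_def
    using assms by (subst nn_integral_distr) auto
  finally show ?thesis .
qed

lemma laplace_add:
  assumes "0 \<le> s" "0 \<le> t"
  shows "laplace \<xi> (s + t) = laplace \<xi> s * laplace \<xi> t"
proof (cases "s = 0 \<or> t = 0")
  case True then show ?thesis by (auto simp: laplace_0)
next
  case False
  then have st: "0 < s" "0 < t" using assms by auto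
  define \<tau> where "\<tau> i = (if i = 0 then 0 else if i = 1 then s else s + t)" for i :: nat
  define X where "X i \<omega> = (if i = 0 then Y 0 \<omega> else Y (\<tau> i) \<omega> - Y (\<tau> (i - 1)) \<omega>)" for i \<omega>
  have "indep_vars (\<lambda>_. borel) X {..2}"
    unfolding X_def
  proof (rule increments_indep)
    fix i :: nat assume "i < 2"
    then show "\<tau> i < \<tau> (Suc i)" using st by (auto simp: \<tau>_def less_2_cases_iff)
  qed (simp add: \<tau>_def)
  then have "indep_vars (\<lambda>_. borel) X {1, 2}" by (rule indep_vars_subset) auto
  then have ind: "indep_vars (\<lambda>_. borel) (\<lambda>i \<omega>. ennreal (exp (- \<xi> * X i \<omega>))) {1, 2}"
    by (rule indep_vars_compose2) measurable
  have "(\<integral>\<^sup>+ \<omega>. (\<Prod>i\<in>{1, 2}. ennreal (exp (- \<xi> * X i \<omega>))) \<partial>M)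
    = (\<Prod>i\<in>{1, 2}. \<integral>\<^sup>+ \<omega>. ennreal (exp (- \<xi> * X i \<omega>)) \<partial>M)"
    by (rule indep_vars_nn_integral[OF _ ind]) auto
  moreover have "(\<Prod>i\<in>{1, 2::nat}. ennreal (exp (- \<xi> * X i \<omega>))) = ennreal (exp (- \<xi> * (Y (s + t) \<omega> - Y 0 \<omega>)))" for \<omega>
    by (simp add: X_def \<tau>_def ennreal_mult[symmetric] algebra_simps flip: exp_add)
  ultimately have "laplace \<xi> (s + t) = laplace \<xi> s * (\<integral>\<^sup>+ \<omega>. ennreal (exp (- \<xi> * (Y (s + t) \<omega> - Y s \<omega>))) \<partial>M)"
    by (simp add: laplace_def X_def \<tau>_def)
  then show ?thesis using laplace_increment[OF assms] by simp
qed

lemma laplace_mult: "0 \<le> h \<Longrightarrow> laplace \<xi> (real k * h) = laplace \<xi> h ^ k"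
proof (induction k)
  case (Suc k)
  have "laplace \<xi> (real (Suc k) * h) = laplace \<xi> (h + real k * h)" by (simp add: algebra_simps)
  also have "\<dots> = laplace \<xi> h ^ Suc k" using Suc by (subst laplace_add) auto
  finally show ?case .
qed (simp add: laplace_0)

text \<open>Multiplicativity determines the transform at dyadic times and Fatou extends the upper bound to
  all times; applied to the complementary time, the upper bound gives the lower one.\<close>

lemma laplace_eq:
  assumes 1: "laplace \<xi> 1 = ennreal (exp a)" and t: "0 \<le> t"
  shows "laplace \<xi> t = ennreal (exp (t * a))"
proof -
  have dy: "laplace \<xi> (real k / 2 ^ n) = ennreal (exp (real k / 2 ^ n * a))" for k n
  proof -
    have "laplace \<xi> (1 / 2 ^ n) ^ (2 ^ n) = laplace \<xi> (real (2 ^ n) * (1 / 2 ^ n))"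
      by (rule laplace_mult[symmetric]) simp
    then have "laplace \<xi> (1 / 2 ^ n) ^ (2 ^ n) = ennreal (exp a)" using 1 by simp
    then have "laplace \<xi> (1 / 2 ^ n) = ennreal (exp (a / real (2 ^ n)))" by (rule ennreal_root) simp
    then have "laplace \<xi> (real k * (1 / 2 ^ n)) = ennreal (exp (a / real (2 ^ n))) ^ k"
      by (simp only: laplace_mult[of "1 / 2 ^ n"] zero_le_divide_1_iff zero_le_power zero_le_numeral)
    then show ?thesis by (simp add: ennreal_power field_simps flip: exp_of_nat_mult)
  qed
  have le: "laplace \<xi> t \<le> ennreal (exp (t * a))" if t: "0 \<le> t" for t
  proof -
    have lim: "(\<lambda>n. ennreal (exp (- \<xi> * (Y (dyadic_above n t) \<omega> - Y 0 \<omega>)))) \<longlonglongrightarrow> ennreal (exp (- \<xi> * (Y t \<omega> - Y 0 \<omega>)))"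
      if "\<omega> \<in> space M" for \<omega>
      by (intro tendsto_intros right_cont_dyadic_limit[OF right_cont_Y[OF that] t])
    have "laplace \<xi> t = (\<integral>\<^sup>+ \<omega>. liminf (\<lambda>n. ennreal (exp (- \<xi> * (Y (dyadic_above n t) \<omega> - Y 0 \<omega>)))) \<partial>M)"
      unfolding laplace_def
      by (rule nn_integral_cong) (rule lim_imp_Liminf[OF _ lim, symmetric], auto)
    also have "\<dots> \<le> liminf (\<lambda>n. laplace \<xi> (dyadic_above n t))"
      unfolding laplace_def by (rule nn_integral_liminf) (use dyadics_nonneg[OF dyadic_above_in] in measurable)
    also have "(\<lambda>n. laplace \<xi> (dyadic_above n t)) = (\<lambda>n. ennreal (exp (dyadic_above n t * a)))"
    proof
      fix n
      obtain k m where "dyadic_above n t = real k / 2 ^ m" using dyadic_above_in[of n t] by (auto simp: dyadics_def)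
      then show "laplace \<xi> (dyadic_above n t) = ennreal (exp (dyadic_above n t * a))" using dy by simp
    qed
    also have "liminf (\<lambda>n. ennreal (exp (dyadic_above n t * a))) = ennreal (exp (t * a))"
    proof (rule lim_imp_Liminf)
      have "(\<lambda>n. dyadic_above n t) \<longlonglongrightarrow> t" using dyadic_above_tendsto[OF t] by (simp add: filterlim_at)
      then show "(\<lambda>n. ennreal (exp (dyadic_above n t * a))) \<longlonglongrightarrow> ennreal (exp (t * a))" by (intro tendsto_intros)
    qed simp
    finally show ?thesis .
  qed
  obtain k :: nat where k: "t \<le> real k" using real_arch_simple by blast
  obtain r where r: "laplace \<xi> t = ennreal r" "0 \<le> r"
    using le[OF t] by (cases "laplace \<xi> t") (auto simp: top_unique)
  have "ennreal (exp (real k * a)) = laplace \<xi> (t + (real k - t))" using dy[of k 0] by simp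
  also have "\<dots> = laplace \<xi> t * laplace \<xi> (real k - t)" using t k by (intro laplace_add) auto
  also have "\<dots> \<le> ennreal r * ennreal (exp ((real k - t) * a))"
    unfolding r by (rule mult_left_mono) (use le k in auto)
  also have "\<dots> = ennreal (r * exp ((real k - t) * a))" using r by (simp add: ennreal_mult)
  finally have "exp (real k * a) \<le> r * exp ((real k - t) * a)"
    using r by (subst (asm) ennreal_le_iff) auto
  then have "exp (t * a) * exp ((real k - t) * a) \<le> r * exp ((real k - t) * a)"
    by (simp add: algebra_simps flip: exp_add)
  then have "exp (t * a) \<le> r" by simp
  then show ?thesis using le[OF t] r by (simp add: antisym)
qed

lemma laplace_1:
  assumes L: "has_laplace_exponent M Y (laplace_exponent \<phi>)" and \<xi>: "0 \<le> \<xi>"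
  shows "laplace \<xi> 1 = ennreal (exp (real_exponent \<phi> \<xi>))"
proof -
  have "(LINT \<omega>|M. exp (- complex_of_real \<xi> * complex_of_real (Y 1 \<omega> - Y 0 \<omega>))) = exp (laplace_exponent \<phi> (complex_of_real \<xi>))"
    using L \<xi> unfolding has_laplace_exponent_def by (metis Re_complex_of_real)
  moreover have "exp (- complex_of_real \<xi> * complex_of_real (Y 1 \<omega> - Y 0 \<omega>)) = complex_of_real (exp (- \<xi> * (Y 1 \<omega> - Y 0 \<omega>)))" for \<omega>
    by (simp flip: exp_of_real)
  ultimately have "complex_of_real (LINT \<omega>|M. exp (- \<xi> * (Y 1 \<omega> - Y 0 \<omega>))) = complex_of_real (exp (real_exponent \<phi> \<xi>))"
    by (simp only: integral_complex_of_real laplace_exponent_of_real exp_of_real)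
  then have eq: "(LINT \<omega>|M. exp (- \<xi> * (Y 1 \<omega> - Y 0 \<omega>))) = exp (real_exponent \<phi> \<xi>)" by (simp only: of_real_eq_iff)
  \<comment> \<open>A function that is not integrable has Bochner integral 0, which is not a value
    of \<open>exp\<close>.\<close>
  then have "integrable M (\<lambda>\<omega>. exp (- \<xi> * (Y 1 \<omega> - Y 0 \<omega>)))"
    using not_integrable_integral_eq[of M "\<lambda>\<omega>. exp (- \<xi> * (Y 1 \<omega> - Y 0 \<omega>))"] exp_not_eq_zero[of "real_exponent \<phi> \<xi>"] by metis
  from nn_integral_eq_integral[OF this] show ?thesis unfolding laplace_def eq by simp
qed

text \<open>Chebyshev for \<open>(exp (- Z s / a) - 1)\<^sup>2\<close>: this needs the Laplace transform at \<open>1 / a\<close> and \<open>2 / a\<close>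
  only, and no moments of \<open>Y\<close>.\<close>

lemma increment_tail:
  assumes adm: "admissible_jump_measure \<phi>" and L: "has_laplace_exponent M Y (laplace_exponent \<phi>)"
    and a: "0 < a" and \<epsilon>: "0 < \<epsilon>" and s: "0 \<le> s" "s \<le> a"
  shows "emeasure M {\<omega> \<in> space M. \<epsilon> * a < \<bar>Z s \<omega>\<bar>}
    \<le> ennreal ((exp (a * real_exponent \<phi> (2 / a)) - 1) / (1 - exp (- \<epsilon>))\<^sup>2)"
proof -
  define W where "W \<omega> = exp (- (1 / a) * (Y s \<omega> - Y 0 \<omega>))" for \<omega>
  have W[measurable]: "W \<in> borel_measurable M" unfolding W_def using s by measurable
  have W2: "(W \<omega>)\<^sup>2 = exp (- (2 / a) * (Y s \<omega> - Y 0 \<omega>))" for \<omega>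
    using exp_of_nat_mult[of 2 "- (1 / a) * (Y s \<omega> - Y 0 \<omega>)"] by (simp add: W_def)
  have W0: "0 \<le> W \<omega>" for \<omega> by (simp add: W_def)
  have "(\<integral>\<^sup>+ \<omega>. ennreal (W \<omega>) \<partial>M) = ennreal (exp (s * real_exponent \<phi> (1 / a)))"
    using laplace_eq[OF laplace_1[OF L, of "1 / a"] s(1)] a by (simp add: laplace_def W_def)
  then have int1: "integrable M W" "(LINT \<omega>|M. W \<omega>) = exp (s * real_exponent \<phi> (1 / a))"
    using nn_integral_eq_integrable[of W M "exp (s * real_exponent \<phi> (1 / a))"] by (auto simp: W0)
  have "(\<integral>\<^sup>+ \<omega>. ennreal ((W \<omega>)\<^sup>2) \<partial>M) = ennreal (exp (s * real_exponent \<phi> (2 / a)))"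
    using laplace_eq[OF laplace_1[OF L, of "2 / a"] s(1)] a by (simp add: laplace_def W2)
  then have int2: "integrable M (\<lambda>\<omega>. (W \<omega>)\<^sup>2)" "(LINT \<omega>|M. (W \<omega>)\<^sup>2) = exp (s * real_exponent \<phi> (2 / a))"
    using nn_integral_eq_integrable[of "\<lambda>\<omega>. (W \<omega>)\<^sup>2" M "exp (s * real_exponent \<phi> (2 / a))"] by auto
  have sq: "(W \<omega> - 1)\<^sup>2 = (W \<omega>)\<^sup>2 - 2 * W \<omega> + 1" for \<omega> by (simp add: power2_diff)
  have int3: "integrable M (\<lambda>\<omega>. (W \<omega> - 1)\<^sup>2)" unfolding sq using int1 int2 by simp
  have "(LINT \<omega>|M. (W \<omega> - 1)\<^sup>2) = exp (s * real_exponent \<phi> (2 / a)) - 2 * exp (s * real_exponent \<phi> (1 / a)) + 1"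
    unfolding sq using int1 int2 by (simp add: prob_space)
  \<comment> \<open>Nonnegativity of the exponent serves twice: it allows \<open>s\<close> to be
    replaced by \<open>a\<close> in the first term, and it bounds the middle exponential below by 1.
    The result is uniform in \<open>s\<close>.\<close>
  also have "\<dots> \<le> exp (a * real_exponent \<phi> (2 / a)) - 1"
  proof -
    have "exp (s * real_exponent \<phi> (2 / a)) \<le> exp (a * real_exponent \<phi> (2 / a))"
      using s a real_exponent_nonneg[OF adm, of "2 / a"] by (simp add: mult_right_mono)
    moreover have "1 \<le> exp (s * real_exponent \<phi> (1 / a))"
      using s a real_exponent_nonneg[OF adm, of "1 / a"] by simp
    ultimately show ?thesis by linarith
  qed
  finally have E: "(LINT \<omega>|M. (W \<omega> - 1)\<^sup>2) \<le> exp (a * real_exponent \<phi> (2 / a)) - 1" .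
  define c where "c = (1 - exp (- \<epsilon>))\<^sup>2"
  have c: "0 < c" using \<epsilon> by (simp add: c_def)
  have "{\<omega> \<in> space M. \<epsilon> * a < \<bar>Z s \<omega>\<bar>} \<subseteq> {\<omega> \<in> space M. c \<le> (W \<omega> - 1)\<^sup>2}"
  proof safe
    fix \<omega> assume "\<epsilon> * a < \<bar>Z s \<omega>\<bar>"
    then have *: "\<epsilon> < \<bar>Z s \<omega> / a\<bar>" using a by (simp add: field_simps)
    have W': "W \<omega> = exp (- (Z s \<omega> / a))" using s by (simp add: W_def Z_def)
    have "1 - exp (- \<epsilon>) \<le> \<bar>W \<omega> - 1\<bar>"
    proof (cases "0 \<le> Z s \<omega> / a")
      case True
      then have "W \<omega> \<le> exp (- \<epsilon>)" using * unfolding W' by simp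
      then show ?thesis by linarith
    next
      case False
      then have "exp \<epsilon> \<le> W \<omega>" using * unfolding W' by simp
      \<comment> \<open>Since \<open>exp \<epsilon> - 1 \<ge> \<epsilon> \<ge> 1 - exp (-
        \<epsilon>)\<close>, the constant for positive \<open>Z s \<omega>\<close> also serves for
        negative values.\<close>
      moreover have "1 + \<epsilon> \<le> exp \<epsilon>" "1 + - \<epsilon> \<le> exp (- \<epsilon>)" by (rule exp_ge_add_one_self)+
      ultimately show ?thesis by linarith
    qed
    then have "(1 - exp (- \<epsilon>))\<^sup>2 \<le> \<bar>W \<omega> - 1\<bar>\<^sup>2" by (rule power_mono) (use \<epsilon> in simp)
    then show "c \<le> (W \<omega> - 1)\<^sup>2" by (simp add: c_def)
  qed
  then have "emeasure M {\<omega> \<in> space M. \<epsilon> * a < \<bar>Z s \<omega>\<bar>} \<le> emeasure M {\<omega> \<in> space M. c \<le> (W \<omega> - 1)\<^sup>2}"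
    by (rule emeasure_mono) measurable
  also have "\<dots> = ennreal (measure M {\<omega> \<in> space M. c \<le> (W \<omega> - 1)\<^sup>2})" by (rule emeasure_eq_measure)
  also have "\<dots> \<le> ennreal ((LINT \<omega>|M. (W \<omega> - 1)\<^sup>2) / c)"
    by (rule ennreal_leI, rule integral_Markov_inequality_measure[OF int3, where A = "{}"]) (use c in auto)
  also have "\<dots> \<le> ennreal ((exp (a * real_exponent \<phi> (2 / a)) - 1) / c)"
    by (rule ennreal_leI, rule divide_right_mono[OF E]) (use c in simp)
  finally show ?thesis by (simp add: c_def)
qed

end

section \<open>Invariance of the uniform distribution\<close>

lemma sets_half_lebesgue: "sets half_lebesgue = sets borel"
  by (simp add: half_lebesgue_def)

lemma nn_integral_half_lebesgue:
  assumes [measurable]: "f \<in> borel_measurable borel"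
  shows "(\<integral>\<^sup>+ x. f x \<partial>half_lebesgue) = ennreal (1 / 2) * (\<integral>\<^sup>+ x. f x * indicator {-1..1} x \<partial>lborel)"
proof -
  have "(\<integral>\<^sup>+ x. f x \<partial>half_lebesgue) = (\<integral>\<^sup>+ x. ennreal (1 / 2) * (f x * indicator {-1..1} x) \<partial>lborel)"
    unfolding half_lebesgue_def by (subst nn_integral_density) (auto simp: mult_ac)
  then show ?thesis by (simp add: nn_integral_cmult)
qed

lemma emeasure_half_lebesgue:
  assumes [measurable]: "A \<in> sets borel"
  shows "emeasure half_lebesgue A = ennreal (1 / 2) * emeasure lborel (A \<inter> {-1..1})"
  using nn_integral_half_lebesgue[of "indicator A"] assms
  by (simp add: sets_half_lebesgue flip: indicator_inter_arith)

lemma prob_space_half_lebesgue: "prob_space half_lebesgue"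
proof
  have "emeasure half_lebesgue UNIV = ennreal (1 / 2) * ennreal 2"
    by (subst emeasure_half_lebesgue) (auto simp: emeasure_lborel_Icc_eq)
  also have "\<dots> = 1" by (subst ennreal_mult[symmetric]) auto
  finally show "emeasure half_lebesgue (space half_lebesgue) = 1" by (simp add: half_lebesgue_def)
qed

text \<open>Passing to complements reverses the inequality, because both total masses are 1.\<close>

lemma prob_measure_eqI_le:
  assumes "prob_space A" "prob_space B" "sets A = sets B"
    and le: "\<And>E. E \<in> sets A \<Longrightarrow> emeasure A E \<le> emeasure B E"
  shows "A = B"
proof (rule measure_eqI[OF assms(3)])
  interpret A: prob_space A by fact
  interpret B: prob_space B by fact
  fix E assume E: "E \<in> sets A"
  have le': "A.prob E \<le> B.prob E" if "E \<in> sets A" for E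
    using le[OF that] by (simp add: A.emeasure_eq_measure B.emeasure_eq_measure)
  have "A.prob (space A - E) \<le> B.prob (space A - E)" by (rule le') (use E in auto)
  moreover have "A.prob (space A - E) = 1 - A.prob E" using E by (rule A.prob_compl)
  moreover have "B.prob (space A - E) = 1 - B.prob E"
    using E B.prob_compl[of E] unfolding assms(3) sets_eq_imp_space_eq[OF assms(3)] by simp
  ultimately have "B.prob E \<le> A.prob E" by linarith
  then show "emeasure A E = emeasure B E"
    using le'[OF E] by (simp add: A.emeasure_eq_measure B.emeasure_eq_measure antisym)
qed

section \<open>Measurability of the fast-forwarded process\<close>

lemma N_l_cong:
  assumes "\<And>u. 0 \<le> u \<Longrightarrow> f u = g u" shows "N_l f = N_l g"
proof -
  have "visits {-1<..} f = visits {-1<..} g" using assms by (auto simp: visits_def)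
  then show ?thesis
    using assms[OF real_inverse_clock_nonneg] by (simp add: N_l_def clock_l_eq fun_eq_iff)
qed

lemma NN_well_defined_cong:
  assumes "\<And>u. 0 \<le> u \<Longrightarrow> f u = g u" shows "NN_well_defined f \<longleftrightarrow> NN_well_defined g"
proof -
  have "visits {-1<..} f = visits {-1<..} g" using assms by (auto simp: visits_def)
  then show ?thesis by (simp add: NN_well_defined_def clock_l_eq N_l_cong[OF assms])
qed

context levy_from
begin

lemma Y_path_joint_measurable: "(\<lambda>(\<omega>, u). Y (max 0 u) \<omega>) \<in> borel_measurable (M \<Otimes>\<^sub>M borel)"
  unfolding case_prod_beta by measurable

text \<open>A time change preserves joint measurability in \<open>\<omega>\<close> and time, so
  \<open>time_change_joint_measurable\<close> applies first to the clamped path and then to its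
  image under \<open>N_l\<close>.\<close>

lemma Y_NN_measurable: "Y_NN Y t \<in> borel_measurable M"
proof -
  have l: "(\<lambda>(\<omega>, u). N_l (\<lambda>s. Y (max 0 s) \<omega>) u) \<in> borel_measurable (M \<Otimes>\<^sub>M borel)"
    using time_change_joint_measurable[OF Y_path_joint_measurable, of "{-1<..}"]
    by (simp add: N_l_def clock_l_eq)
  have r: "(\<lambda>(\<omega>, u). N_r (N_l (\<lambda>s. Y (max 0 s) \<omega>)) u) \<in> borel_measurable (M \<Otimes>\<^sub>M borel)"
    using time_change_joint_measurable[OF l, of "{..<1}"]
    by (simp add: N_r_def clock_r_eq)
  have "(\<lambda>\<omega>. (\<omega>, t)) \<in> measurable M (M \<Otimes>\<^sub>M borel)" by measurable
  from measurable_compose[OF this r]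
  have "(\<lambda>\<omega>. N_r (N_l (\<lambda>s. Y (max 0 s) \<omega>)) t) \<in> borel_measurable M" by simp
  moreover have "N_l (\<lambda>s. Y (max 0 s) \<omega>) = N_l (\<lambda>s. Y s \<omega>)" for \<omega> by (rule N_l_cong) simp
  ultimately show ?thesis by (simp add: Y_NN_def[abs_def])
qed

end

text \<open>Dividing the bound for the flow by a large horizon shows that \<open>flow_mass\<close>
  of the hitting event is at most the Lebesgue measure of \<open>U \<inter> E\<close>. Since
  \<open>half_lebesgue\<close> has density at most 1/2 and the start is independent of the
  increments, the bound transfers to the process itself.\<close>

lemma trace_hits_prob_le:
  assumes lv: "levy_process_from half_lebesgue M Y" and adm: "admissible_jump_measure \<phi>"
    and L: "has_laplace_exponent M Y (laplace_exponent \<phi>)" and t: "0 \<le> t" and E: "E \<in> sets borel"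
  shows "emeasure M {\<omega> \<in> space M. trace_hits {-1<..<1} (\<lambda>u. Y (max 0 u) \<omega>) t E} \<le> emeasure half_lebesgue E"
proof -
  interpret levy_from half_lebesgue M Y by standard (rule lv)
  define U where "U = {-1<..<1::real}"
  have U: "open U" "U \<in> sets borel" by (simp_all add: U_def)
  define G where "G = trace_event U t E"
  have G[measurable]: "G \<in> sets (borel \<Otimes>\<^sub>M skeletons)" unfolding G_def using U(2) E by (rule trace_event_measurable)
  have flow_le: "flow_mass G \<le> emeasure lborel (U \<inter> E)"
  proof (rule ennreal_le_epsilon)
    fix e :: real assume e: "0 < e"
    \<comment> \<open>Starting points within \<open>\<epsilon> * a\<close> of 0 cost
      \<open>2 * \<epsilon> * t\<close> per unit of horizon, which this choice keeps below
      \<open>e / 2\<close>; the \<open>t + 1\<close> covers \<open>t = 0\<close>.\<close>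
    define \<epsilon> where "\<epsilon> = e / (4 * (t + 1))"
    have \<epsilon>: "0 < \<epsilon>" "2 * \<epsilon> * t \<le> e / 2" using e t by (simp_all add: \<epsilon>_def field_simps)
    define c where "c = (1 - exp (- \<epsilon>))\<^sup>2"
    define \<delta> where "\<delta> n = (exp (real (Suc n) * real_exponent \<phi> (2 / real (Suc n))) - 1) / c" for n
    have c: "c \<noteq> 0" using \<epsilon> by (simp add: c_def)
    have "(\<lambda>n. \<delta> n) \<longlonglongrightarrow> (exp 0 - 1) / c"
      unfolding \<delta>_def by (intro tendsto_intros real_exponent_tendsto[OF adm] c)
    moreover have "(\<lambda>n. 2 * t / real (Suc n)) \<longlonglongrightarrow> 0"
      by (rule LIMSEQ_Suc[OF lim_const_over_n])
    \<comment> \<open>Per unit of horizon, enlarging the radius by 1 costs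
      \<open>2 * t / real (Suc n)\<close> and the far starting points cost
      \<open>2 * \<delta> n\<close>; both vanish as the horizon \<open>Suc n\<close> grows.\<close>
    ultimately have "(\<lambda>n. 2 * t / real (Suc n) + 2 * \<delta> n) \<longlonglongrightarrow> 0 + 2 * ((exp 0 - 1) / c)"
      by (intro tendsto_intros)
    then have "eventually (\<lambda>n. 2 * t / real (Suc n) + 2 * \<delta> n < e / 2) sequentially"
      by (rule order_tendstoD) (use e in simp)
    then obtain n where n: "2 * t / real (Suc n) + 2 * \<delta> n < e / 2" by (auto simp: eventually_sequentially)
    define a where "a = real (Suc n)"
    have a: "0 < a" by (simp add: a_def)
    have \<delta>0: "0 \<le> \<delta> n"
      using real_exponent_nonneg[OF adm, of "2 / a"] a unfolding \<delta>_def c_def a_def[symmetric] by simp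
    have "ennreal a * flow_mass G \<le> ennreal a * emeasure lborel (U \<inter> E)
      + (\<integral>\<^sup>+ p. ennreal (min t (occ (visits U (\<lambda>u. fst p + Z u (snd p))) a)) \<partial>flow)"
      unfolding G_def by (rule trace_event_flow_le[OF U(1) E t]) (use a in simp)
    also have "(\<integral>\<^sup>+ p. ennreal (min t (occ (visits U (\<lambda>u. fst p + Z u (snd p))) a)) \<partial>flow)
      \<le> ennreal (2 * (\<epsilon> * a + 1) * t) + ennreal a * (2 * ennreal (\<delta> n))"
      unfolding U_def
    proof (rule occupation_le)
      fix s assume s: "0 \<le> s" "s \<le> a"
      \<comment> \<open>The radius is \<open>\<epsilon> * a + 1\<close>, so that the displacement
        \<open>R - 1\<close> in \<open>occupation_le\<close> is the threshold
        \<open>\<epsilon> * a\<close> of \<open>increment_tail\<close>.\<close>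
      show "emeasure M {\<omega> \<in> space M. \<epsilon> * a + 1 - 1 < \<bar>Z s \<omega>\<bar>} \<le> ennreal (\<delta> n)"
        using increment_tail[OF adm L a \<epsilon>(1) s] by (simp add: \<delta>_def c_def a_def)
    qed (use a \<epsilon> t in auto)
    also have "ennreal (2 * (\<epsilon> * a + 1) * t) + ennreal a * (2 * ennreal (\<delta> n))
      = ennreal a * ennreal (2 * \<epsilon> * t + 2 * t / a + 2 * \<delta> n)"
    proof -
      have "ennreal a * (2 * ennreal (\<delta> n)) = ennreal (a * (2 * \<delta> n))"
        using a \<delta>0 by (simp add: ennreal_mult)
      moreover have "2 * (\<epsilon> * a + 1) * t + a * (2 * \<delta> n) = a * (2 * \<epsilon> * t + 2 * t / a + 2 * \<delta> n)"
        using a by (simp add: field_simps)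
      ultimately show ?thesis
        using a \<delta>0 t \<epsilon> by (simp add: ennreal_mult[symmetric] ennreal_plus[symmetric] del: ennreal_plus)
    qed
    also have "ennreal a * ennreal (2 * \<epsilon> * t + 2 * t / a + 2 * \<delta> n) \<le> ennreal a * ennreal e"
      by (intro mult_left_mono ennreal_leI) (use n \<epsilon>(2) in \<open>auto simp: a_def\<close>)
    finally have "ennreal a * flow_mass G \<le> ennreal a * (emeasure lborel (U \<inter> E) + ennreal e)"
      by (simp add: distrib_left add_left_mono)
    then show "flow_mass G \<le> emeasure lborel (U \<inter> E) + ennreal e"
      using a by (subst (asm) ennreal_mult_le_mult_iff) auto
  qed
  have iff: "trace_hits U (\<lambda>u. Y (max 0 u) \<omega>) t E \<longleftrightarrow> trace_hits U (\<lambda>u. Y 0 \<omega> + Z u \<omega>) t E" for \<omega>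
    by (rule trace_hits_cong) (simp add: Z_def)
  \<comment> \<open>\<open>trace_event\<close> asks for a start in the open interval. Other starts
    are split off here; among them \<open>half_lebesgue\<close> sees only the two endpoints, a null
    set.\<close>
  have sub: "{\<omega> \<in> space M. trace_hits U (\<lambda>u. Y (max 0 u) \<omega>) t E}
    \<subseteq> {\<omega> \<in> space M. (Y 0 \<omega>, shifted_skeleton 0 \<omega>) \<in> G} \<union> (Y 0 -` (- U) \<inter> space M)"
  proof
    fix \<omega> assume "\<omega> \<in> {\<omega> \<in> space M. trace_hits U (\<lambda>u. Y (max 0 u) \<omega>) t E}"
    then have \<omega>: "\<omega> \<in> space M" "trace_hits U (\<lambda>u. Y 0 \<omega> + Z u \<omega>) t E" by (simp_all only: mem_Collect_eq iff)
    have "Z 0 \<omega> = 0" by (simp add: Z_def)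
    then have "(Y 0 \<omega>, shifted_skeleton 0 \<omega>) \<in> G \<longleftrightarrow> Y 0 \<omega> \<in> U"
      using trace_event_iff[OF \<omega>(1) order_refl, of "Y 0 \<omega>" U t E] \<omega>(2)
      by (simp only: G_def add_0_left add_0_right simp_thms)
    then show "\<omega> \<in> {\<omega> \<in> space M. (Y 0 \<omega>, shifted_skeleton 0 \<omega>) \<in> G} \<union> (Y 0 -` (- U) \<inter> space M)"
      using \<omega>(1) by simp
  qed
  have m[measurable]: "(\<lambda>\<omega>. (Y 0 \<omega>, shifted_skeleton 0 \<omega>)) \<in> measurable M (borel \<Otimes>\<^sub>M skeletons)" by measurable
  have m1: "{\<omega> \<in> space M. (Y 0 \<omega>, shifted_skeleton 0 \<omega>) \<in> G} \<in> sets M" by measurable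
  have m2: "Y 0 -` (- U) \<inter> space M \<in> sets M" using U(2) by measurable
  have "emeasure M (Y 0 -` (- U) \<inter> space M) = emeasure half_lebesgue (- U)"
    unfolding distr_Y0[symmetric] using U(2) by (subst emeasure_distr) auto
  also have "\<dots> = ennreal (1 / 2) * emeasure lborel (- U \<inter> {-1..1})"
    using U(2) by (intro emeasure_half_lebesgue) auto
  also have "- U \<inter> {-1..1} = {-1, 1}" by (auto simp: U_def)
  finally have out: "emeasure M (Y 0 -` (- U) \<inter> space M) = 0"
    by (simp add: emeasure_lborel_countable)
  interpret K: prob_space "distr M skeletons (shifted_skeleton 0)" by (rule prob_space_distr) measurable
  interpret H: prob_space half_lebesgue by (rule prob_space_half_lebesgue)
  interpret HK: pair_sigma_finite half_lebesgue "distr M skeletons (shifted_skeleton 0)" by standard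
  have sets_eq: "sets (half_lebesgue \<Otimes>\<^sub>M distr M skeletons (shifted_skeleton 0)) = sets (borel \<Otimes>\<^sub>M skeletons)"
    by (rule sets_pair_measure_cong) (simp_all add: sets_half_lebesgue)
  have G': "G \<in> sets (half_lebesgue \<Otimes>\<^sub>M distr M skeletons (shifted_skeleton 0))"
    unfolding sets_eq by (rule G)
  have "emeasure M {\<omega> \<in> space M. (Y 0 \<omega>, shifted_skeleton 0 \<omega>) \<in> G}
    = emeasure (distr M (borel \<Otimes>\<^sub>M skeletons) (\<lambda>\<omega>. (Y 0 \<omega>, shifted_skeleton 0 \<omega>))) G"
    by (subst emeasure_distr[OF m G]) (auto intro!: arg_cong[where f = "emeasure M"])
  also have "\<dots> = (\<integral>\<^sup>+ p. indicator G p \<partial>(half_lebesgue \<Otimes>\<^sub>M distr M skeletons (shifted_skeleton 0)))"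
    unfolding distr_Y0_skeleton by (rule nn_integral_indicator[OF G', symmetric])
  also have "\<dots> = (\<integral>\<^sup>+ z. \<integral>\<^sup>+ x. indicator G (x, z) \<partial>half_lebesgue \<partial>distr M skeletons (shifted_skeleton 0))"
    by (rule HK.nn_integral_snd[OF borel_measurable_indicator[OF G'], symmetric])
  also have "\<dots> \<le> (\<integral>\<^sup>+ z. ennreal (1 / 2) * (\<integral>\<^sup>+ x. indicator G (x, z) \<partial>lborel) \<partial>distr M skeletons (shifted_skeleton 0))"
  proof (rule nn_integral_mono)
    fix z assume "z \<in> space (distr M skeletons (shifted_skeleton 0))"
    then have [measurable]: "z \<in> space skeletons" by simp
    have "(\<lambda>x. indicator G (x, z) :: ennreal) \<in> borel_measurable borel" by measurable
    from nn_integral_half_lebesgue[OF this]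
    show "(\<integral>\<^sup>+ x. indicator G (x, z) \<partial>half_lebesgue) \<le> ennreal (1 / 2) * (\<integral>\<^sup>+ x. indicator G (x, z) \<partial>lborel)"
      by (auto intro!: mult_left_mono nn_integral_mono simp: indicator_def)
  qed
  also have "\<dots> = ennreal (1 / 2) * flow_mass G"
  proof -
    have "(\<lambda>z. \<integral>\<^sup>+ x. indicator G (x, z) \<partial>lborel) \<in> borel_measurable skeletons"
      by (rule lborel.borel_measurable_nn_integral) measurable
    then show ?thesis unfolding flow_mass_def by (intro nn_integral_cmult) simp
  qed
  also have "\<dots> \<le> ennreal (1 / 2) * emeasure lborel (E \<inter> {-1..1})"
    by (rule mult_left_mono[OF order_trans[OF flow_le emeasure_mono]]) (use E in \<open>auto simp: U_def\<close>)
  also have "\<dots> = emeasure half_lebesgue E" by (rule emeasure_half_lebesgue[OF E, symmetric])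
  finally have inn: "emeasure M {\<omega> \<in> space M. (Y 0 \<omega>, shifted_skeleton 0 \<omega>) \<in> G} \<le> emeasure half_lebesgue E" .
  have "emeasure M {\<omega> \<in> space M. trace_hits U (\<lambda>u. Y (max 0 u) \<omega>) t E}
    \<le> emeasure M ({\<omega> \<in> space M. (Y 0 \<omega>, shifted_skeleton 0 \<omega>) \<in> G} \<union> (Y 0 -` (- U) \<inter> space M))"
    by (rule emeasure_mono[OF sub]) (use m1 m2 in auto)
  also have "\<dots> \<le> emeasure M {\<omega> \<in> space M. (Y 0 \<omega>, shifted_skeleton 0 \<omega>) \<in> G} + emeasure M (Y 0 -` (- U) \<inter> space M)"
    by (rule emeasure_subadditive[OF m1 m2])
  also have "\<dots> \<le> emeasure half_lebesgue E" using inn by (simp only: out add_0_right)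
  finally show ?thesis by (simp only: U_def)
qed

theorem corollary5p5:
  fixes \<phi> :: "real measure" and M :: "'a measure" and Y :: "real \<Rightarrow> 'a \<Rightarrow> real"
  assumes "admissible_jump_measure \<phi>"
    and "levy_process_from half_lebesgue M Y"
    and "has_laplace_exponent M Y (laplace_exponent \<phi>)"
  shows "prob_space half_lebesgue \<and>
    (AE \<omega> in M. NN_well_defined (\<lambda>s. Y s \<omega>)) \<and>
    (\<forall>t>0. Y_NN Y t \<in> borel_measurable M \<and> distr M borel (Y_NN Y t) = half_lebesgue)"
proof -
  interpret levy_from half_lebesgue M Y by standard (rule assms(2))
  define U where "U = {-1<..<1::real}"
  define w where "w \<omega> = (\<lambda>u. Y (max 0 u) \<omega>)" for \<omega>
  define \<tau> where "\<tau> \<omega> t = inverse_clock (occ (visits U (w \<omega>))) t" for \<omega> t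
  have hits_le: "emeasure M {\<omega> \<in> space M. trace_hits U (w \<omega>) t E} \<le> emeasure half_lebesgue E"
    if "0 \<le> t" "E \<in> sets borel" for t E
    unfolding U_def w_def by (rule trace_hits_prob_le[OF assms(2,1,3) that])
  have hits_sets: "{\<omega> \<in> space M. trace_hits U (w \<omega>) t E} \<in> sets M" if "E \<in> sets borel" for t E
    unfolding w_def by (rule trace_hits_joint_measurable[OF Y_path_joint_measurable _ that]) (simp add: U_def)
  \<comment> \<open>With \<open>E = {}\<close> a hit can only mean an infinite inverse clock, and
    its probability is bounded by the mass of the empty set. Integer levels suffice, since an
    inverse clock finite at one level is finite at all lower ones.\<close>
  have "AE \<omega> in M. \<tau> \<omega> (real n) \<noteq> \<infinity>" for n
  proof (rule AE_I)
    show "{\<omega> \<in> space M. \<not> \<tau> \<omega> (real n) \<noteq> \<infinity>} \<subseteq> {\<omega> \<in> space M. trace_hits U (w \<omega>) (real n) {}}"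
      by (auto simp: trace_hits_def \<tau>_def)
    show "emeasure M {\<omega> \<in> space M. trace_hits U (w \<omega>) (real n) {}} = 0"
      using hits_le[of "real n" "{}"] by simp
    show "{\<omega> \<in> space M. trace_hits U (w \<omega>) (real n) {}} \<in> sets M" by (rule hits_sets) simp
  qed
  then have unbounded: "AE \<omega> in M. \<forall>n. \<tau> \<omega> (real n) \<noteq> \<infinity>" by (simp add: AE_all_countable)
  have good: "AE \<omega> in M. NN_well_defined (\<lambda>s. Y s \<omega>) \<and> (\<forall>t\<ge>0. Y_NN Y t \<omega> = w \<omega> (real_of_ereal (\<tau> \<omega> t)))"
    using AE_space unbounded
  proof eventually_elim
    fix \<omega> assume *: "\<omega> \<in> space M" and fin: "\<forall>n. \<tau> \<omega> (real n) \<noteq> \<infinity>"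
    have eq: "w \<omega> u = Y u \<omega>" if "0 \<le> u" for u using that by (simp add: w_def)
    have fin': "inverse_clock (occ (visits {-1<..<1} (w \<omega>))) t \<noteq> \<infinity>" if "0 \<le> t" for t
    proof -
      obtain n :: nat where n: "t \<le> real n" using real_arch_simple by blast
      obtain u where "0 < u" "real n < occ (visits U (w \<omega>)) u"
        using fin by (auto simp: \<tau>_def inverse_clock_infinite_iff not_le)
      then show ?thesis
        using n by (auto simp: U_def inverse_clock_infinite_iff not_le intro!: exI[of _ u])
    qed
    have mw: "w \<omega> \<in> borel_measurable borel" using * unfolding w_def by measurable
    have rc: "right_cont_path (w \<omega>)"
      using flow_path(2)[OF *, of "Y 0 \<omega>"] by (simp add: w_def Z_def)
    have "NN_well_defined (w \<omega>)" by (rule N_r_N_l(1)[OF mw rc fin'])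
    moreover have "N_r (N_l (w \<omega>)) t = w \<omega> (real_of_ereal (\<tau> \<omega> t))" if "0 \<le> t" for t
      unfolding \<tau>_def U_def by (rule N_r_N_l(2)[OF mw rc fin' that])
    moreover have "NN_well_defined (w \<omega>) \<longleftrightarrow> NN_well_defined (\<lambda>s. Y s \<omega>)"
      by (rule NN_well_defined_cong) (rule eq)
    moreover have "N_l (w \<omega>) = N_l (\<lambda>s. Y s \<omega>)"
      by (rule N_l_cong) (rule eq)
    ultimately show "NN_well_defined (\<lambda>s. Y s \<omega>) \<and> (\<forall>t\<ge>0. Y_NN Y t \<omega> = w \<omega> (real_of_ereal (\<tau> \<omega> t)))"
      by (simp add: Y_NN_def)
  qed
  \<comment> \<open>The hitting bound only dominates the law by \<open>half_lebesgue\<close>; both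
    being probability measures turns this into equality.\<close>
  have "distr M borel (Y_NN Y t) = half_lebesgue" if t: "0 < t" for t
  proof (rule prob_measure_eqI_le[OF prob_space_distr[OF Y_NN_measurable] prob_space_half_lebesgue])
    show "sets (distr M borel (Y_NN Y t)) = sets half_lebesgue" by (simp add: sets_half_lebesgue)
    fix E assume "E \<in> sets (distr M borel (Y_NN Y t))"
    then have E: "E \<in> sets borel" by simp
    have "emeasure (distr M borel (Y_NN Y t)) E = emeasure M (Y_NN Y t -` E \<inter> space M)"
      by (rule emeasure_distr[OF Y_NN_measurable E])
    also have "\<dots> \<le> emeasure M {\<omega> \<in> space M. trace_hits U (w \<omega>) t E}"
    proof (rule emeasure_mono_AE[OF _ hits_sets[OF E]])
      show "AE \<omega> in M. \<omega> \<in> Y_NN Y t -` E \<inter> space M \<longrightarrow> \<omega> \<in> {\<omega> \<in> space M. trace_hits U (w \<omega>) t E}"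
        using good by eventually_elim (use t in \<open>auto simp: trace_hits_def \<tau>_def\<close>)
    qed
    also have "\<dots> \<le> emeasure half_lebesgue E" by (rule hits_le) (use t E in auto)
    finally show "emeasure (distr M borel (Y_NN Y t)) E \<le> emeasure half_lebesgue E" .
  qed
  moreover have "AE \<omega> in M. NN_well_defined (\<lambda>s. Y s \<omega>)" using good by eventually_elim simp
  ultimately show ?thesis using prob_space_half_lebesgue Y_NN_measurable by blast
qed

end
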